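(* Let $\Sigma^2$ be an oriented $2$-manifold, let $f:\Sigma^2\to\mathbb R^3$ be a front in the Euclidean $3$-space, let $p$ be a cuspidal edge of $f$, let $\gamma(t)$ be the singular curve with $\gamma(0)=p$, and put $\hat\gamma=f\circ\gamma$. Let $P$ be the plane passing through $f(p)$ perpendicular to $\hat\gamma'(0)$. Then the intersection of $P$ with the image under $f$ of a small neighborhood of $p$ consists of a $3/2$-cusp $\sigma$ in $P$. Furthermore, the cuspidal curvature $\kappa_c(0)$ of $f$ at $p=\gamma(0)$ coincides with the cuspidal curvature (as a plane curve in $P$) of $\sigma$ at the cusp $f(p)$. Here $P$ is oriented so that a basis $(e_1,e_2)$ of its direction plane is positive if and only if $(\hat\gamma'(0),e_1,e_2)$ is positive in $\mathbb R^3$, and $\sigma=f\circ c$ is parametrized by a regular curve $c$ in $\Sigma^2$ with $c(0)=p$ such that $\{\gamma'(0),c'(0)\}$ is positively oriented.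
   Context: All maps are $C^\infty$. A singular point of $f$ is a point where $f$ is not an immersion. $f$ is a frontal if around each point there is a unit vector field $\nu$ along $f$ orthogonal to $df(a)$ for all tangent vectors $a$; it is a front if moreover $(f,\nu)$ is an immersion. A singular point $p$ is a cuspidal edge if the map germ of $f$ at $p$ is right-left equivalent (equivalent under diffeomorphism germs of source and target) to $(u,v)\mapsto(u,v^2,v^3)$ at the origin. Near a cuspidal edge the singular set is a regular curve $\gamma$ in $\Sigma^2$ (the singular curve), $df$ has rank one along $\gamma$, and the kernel of $df$ is transversal to $\gamma'$. Cuspidal curvature of a cuspidal edge: let $\eta$ be a vector field near $p$ which along $\gamma$ is non-vanishing and satisfies $df(\eta)=0$, with $\{\gamma',\eta\}$ positively oriented; put $f_\eta=df(\eta)$ and let $f_{\eta\eta}$, $f_{\eta\eta\eta}$ be the successive derivatives of $f_\eta$ in the direction $\eta$. Then $$\kappa_c(t)=\frac{|\hat\gamma'(t)|^{3/2}\det\bigl(\hat\gamma'(t),f_{\eta\eta}(\gamma(t)),f_{\eta\eta\eta}(\gamma(t))\bigr)}{|\hat\gamma'(t)\times f_{\eta\eta}(\gamma(t))|^{5/2}}.$$ Cuspidal curvature of a plane cusp: a plane curve $\sigma(t)$ has a $3/2$-cusp at $t=0$ if $\sigma'(0)=0$ and $\det(\sigma''(0),\sigma'''(0))\neq0$; its cuspidal curvature is $$\tau=\frac{\det(\sigma''(0),\sigma'''(0))}{|\sigma''(0)|^{5/2}}.$$ *)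

theory Defs
  imports "HOL-Analysis.Analysis"
begin

section \<open>Smooth maps between Euclidean spaces\<close>

text \<open>Meant for open sets \<open>S\<close>, on which this is the usual notion of a $C^n$ map.\<close>

primrec Ck_on ::
  "nat \<Rightarrow> 'a::euclidean_space set \<Rightarrow> ('a \<Rightarrow> 'b::euclidean_space) \<Rightarrow> bool" where
  "Ck_on 0 S f \<longleftrightarrow> continuous_on S f"
| "Ck_on (Suc n) S f \<longleftrightarrow>
     (\<forall>x\<in>S. f differentiable (at x)) \<and> (\<forall>v. Ck_on n S (\<lambda>x. frechet_derivative f (at x) v))"

definition smooth_on :: "'a::euclidean_space set \<Rightarrow> ('a \<Rightarrow> 'b::euclidean_space) \<Rightarrow> bool" where
  "smooth_on S f \<longleftrightarrow> (\<forall>n. Ck_on n S f)"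

definition diffeo_between ::
  "'a::euclidean_space set \<Rightarrow> 'a set \<Rightarrow> ('a \<Rightarrow> 'a) \<Rightarrow> bool" where
  "diffeo_between C D \<Psi> \<longleftrightarrow> open C \<and> open D \<and> bij_betw \<Psi> C D \<and>
     smooth_on C \<Psi> \<and> smooth_on D (inv_into C \<Psi>)"


section \<open>Oriented smooth surfaces\<close>

text \<open>
  A chart is a pair of an open domain \<open>U\<close> and a map \<open>\<phi>\<close>; the values of \<open>\<phi>\<close> outside \<open>U\<close> are
  irrelevant and its inverse is \<open>inv_into U \<phi>\<close>. The surface \<open>M\<close> is an open subset of the ambient
  (Hausdorff, second countable) type, and it is oriented by an atlas all of whose transition maps
  have positive Jacobian determinant.
\<close>

type_synonym 'a chart2 = "'a set \<times> ('a \<Rightarrow> real^2)"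

definition oriented_surface ::
  "'a::{t2_space,second_countable_topology} set \<Rightarrow> 'a chart2 set \<Rightarrow> bool" where
  "oriented_surface M \<A> \<longleftrightarrow>
     M = (\<Union>(U,\<phi>)\<in>\<A>. U) \<and>
     (\<forall>(U,\<phi>)\<in>\<A>. open U \<and> open (\<phi> ` U) \<and> homeomorphism U (\<phi> ` U) \<phi> (inv_into U \<phi>)) \<and>
     (\<forall>(U,\<phi>)\<in>\<A>. \<forall>(V,\<psi>)\<in>\<A>.
        smooth_on (\<phi> ` (U \<inter> V)) (\<psi> \<circ> inv_into U \<phi>) \<and>
        (\<forall>x\<in>\<phi> ` (U \<inter> V). det (matrix (frechet_derivative (\<psi> \<circ> inv_into U \<phi>) (at x))) > 0))"

definition smooth_map_on ::
  "'a chart2 set \<Rightarrow> 'a set \<Rightarrow> ('a \<Rightarrow> 'b::euclidean_space) \<Rightarrow> bool" where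
  "smooth_map_on \<A> W h \<longleftrightarrow> (\<forall>(U,\<phi>)\<in>\<A>. smooth_on (\<phi> ` (U \<inter> W)) (h \<circ> inv_into U \<phi>))"

text \<open>
  Tangent vectors at \<open>q\<close> are represented by their coordinates in a chart \<open>(U,\<phi>)\<close> around \<open>q\<close>.
\<close>

definition differential ::
  "'a chart2 \<Rightarrow> ('a \<Rightarrow> 'b::euclidean_space) \<Rightarrow> 'a \<Rightarrow> real^2 \<Rightarrow> 'b" where
  "differential = (\<lambda>(U,\<phi>) h q. frechet_derivative (h \<circ> inv_into U \<phi>) (at (\<phi> q)))"

definition immersive_at :: "'a chart2 set \<Rightarrow> ('a \<Rightarrow> 'b::euclidean_space) \<Rightarrow> 'a \<Rightarrow> bool" where
  "immersive_at \<A> h q \<longleftrightarrow> (\<forall>(U,\<phi>)\<in>\<A>. q \<in> U \<longrightarrow> inj (differential (U,\<phi>) h q))"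

text \<open>A diffeomorphism from \<open>W \<subseteq> M\<close> onto an open subset of the plane (of either orientation).\<close>

definition local_coordinates ::
  "'a::{t2_space,second_countable_topology} set \<Rightarrow> 'a chart2 set \<Rightarrow> 'a set \<Rightarrow> ('a \<Rightarrow> real^2) \<Rightarrow> bool"
  where
  "local_coordinates M \<A> W \<Phi> \<longleftrightarrow>
     open W \<and> W \<subseteq> M \<and> open (\<Phi> ` W) \<and> inj_on \<Phi> W \<and> smooth_map_on \<A> W \<Phi> \<and>
     (\<forall>(U,\<phi>)\<in>\<A>. smooth_on (\<Phi> ` (U \<inter> W)) (\<phi> \<circ> inv_into W \<Phi>))"

definition regular_curve ::
  "'a::{t2_space,second_countable_topology} set \<Rightarrow> 'a chart2 set \<Rightarrow> real set \<Rightarrow> (real \<Rightarrow> 'a) \<Rightarrow> bool"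
  where
  "regular_curve M \<A> I c \<longleftrightarrow>
     open I \<and> is_interval I \<and> c ` I \<subseteq> M \<and> continuous_on I c \<and>
     (\<forall>(U,\<phi>)\<in>\<A>. smooth_on (I \<inter> c -` U) (\<phi> \<circ> c) \<and>
        (\<forall>t\<in>I \<inter> c -` U. vector_derivative (\<phi> \<circ> c) (at t) \<noteq> 0))"

definition positive_pair :: "real^2 \<Rightarrow> real^2 \<Rightarrow> bool" where
  "positive_pair a b \<longleftrightarrow> det (vector [a, b] :: real^2^2) > 0"

text \<open>Orientation of the velocities at \<open>0\<close> of two curves with \<open>\<gamma> 0 = c 0\<close>.\<close>

definition positively_oriented_curves ::
  "'a chart2 set \<Rightarrow> (real \<Rightarrow> 'a) \<Rightarrow> (real \<Rightarrow> 'a) \<Rightarrow> bool" where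
  "positively_oriented_curves \<A> \<gamma> c \<longleftrightarrow>
     (\<forall>(U,\<phi>)\<in>\<A>. \<gamma> 0 \<in> U \<longrightarrow>
        positive_pair (vector_derivative (\<phi> \<circ> \<gamma>) (at 0)) (vector_derivative (\<phi> \<circ> c) (at 0)))"


section \<open>Fronts and cuspidal edges\<close>

definition unit_normal_on ::
  "'a chart2 set \<Rightarrow> ('a \<Rightarrow> real^3) \<Rightarrow> 'a set \<Rightarrow> ('a \<Rightarrow> real^3) \<Rightarrow> bool" where
  "unit_normal_on \<A> f W \<nu> \<longleftrightarrow>
     smooth_map_on \<A> W \<nu> \<and>
     (\<forall>q\<in>W. norm (\<nu> q) = 1 \<and>
        (\<forall>(U,\<phi>)\<in>\<A>. q \<in> U \<longrightarrow> (\<forall>a. \<nu> q \<bullet> differential (U,\<phi>) f q a = 0)))"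

definition front ::
  "'a::{t2_space,second_countable_topology} set \<Rightarrow> 'a chart2 set \<Rightarrow> ('a \<Rightarrow> real^3) \<Rightarrow> bool" where
  "front M \<A> f \<longleftrightarrow>
     smooth_map_on \<A> M f \<and>
     (\<forall>q\<in>M. \<exists>W \<nu>. open W \<and> q \<in> W \<and> W \<subseteq> M \<and> unit_normal_on \<A> f W \<nu> \<and>
        (\<forall>x\<in>W. immersive_at \<A> (\<lambda>y. (f y, \<nu> y)) x))"

definition singular_set ::
  "'a::{t2_space,second_countable_topology} set \<Rightarrow> 'a chart2 set \<Rightarrow> ('a \<Rightarrow> real^3) \<Rightarrow> 'a set" where
  "singular_set M \<A> f = {q\<in>M. \<not> immersive_at \<A> f q}"

definition standard_cuspidal_edge :: "real^2 \<Rightarrow> real^3" where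
  "standard_cuspidal_edge x = vector [x $ 1, (x $ 2)\<^sup>2, (x $ 2) ^ 3]"

definition cuspidal_edge ::
  "'a::{t2_space,second_countable_topology} set \<Rightarrow> 'a chart2 set \<Rightarrow> ('a \<Rightarrow> real^3) \<Rightarrow> 'a \<Rightarrow> bool" where
  "cuspidal_edge M \<A> f p \<longleftrightarrow>
     p \<in> singular_set M \<A> f \<and>
     (\<exists>W \<Phi> C D \<Psi>. local_coordinates M \<A> W \<Phi> \<and> p \<in> W \<and> \<Phi> p = 0 \<and>
        diffeo_between C D \<Psi> \<and> f ` W \<subseteq> C \<and> \<Psi> (f p) = 0 \<and>
        (\<forall>q\<in>W. \<Psi> (f q) = standard_cuspidal_edge (\<Phi> q)))"

text \<open>A regular curve through \<open>p\<close> which parametrizes the singular set near \<open>p\<close>.\<close>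

definition singular_curve ::
  "'a::{t2_space,second_countable_topology} set \<Rightarrow> 'a chart2 set \<Rightarrow> ('a \<Rightarrow> real^3) \<Rightarrow> 'a \<Rightarrow>
     real set \<Rightarrow> (real \<Rightarrow> 'a) \<Rightarrow> bool" where
  "singular_curve M \<A> f p I \<gamma> \<longleftrightarrow>
     regular_curve M \<A> I \<gamma> \<and> 0 \<in> I \<and> \<gamma> 0 = p \<and>
     (\<exists>V. open V \<and> p \<in> V \<and> V \<inter> singular_set M \<A> f = V \<inter> \<gamma> ` I)"


section \<open>Cuspidal curvature of a cuspidal edge\<close>

text \<open>
  \<open>\<eta>\<close> is the coordinate expression in the chart \<open>(U,\<phi>)\<close> of a vector field near \<open>\<gamma> 0\<close>, defined
  on the open set \<open>A \<subseteq> \<phi> ` U\<close>; the conditions along \<open>\<gamma>\<close> are imposed near \<open>\<gamma> 0\<close> only.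
\<close>

definition null_vector_field ::
  "('a \<Rightarrow> real^3) \<Rightarrow> (real \<Rightarrow> 'a) \<Rightarrow> 'a chart2 \<Rightarrow> (real^2) set \<Rightarrow> (real^2 \<Rightarrow> real^2) \<Rightarrow> bool" where
  "null_vector_field = (\<lambda>f \<gamma> (U,\<phi>) A \<eta>.
     \<gamma> 0 \<in> U \<and> open A \<and> \<phi> (\<gamma> 0) \<in> A \<and> A \<subseteq> \<phi> ` U \<and> smooth_on A \<eta> \<and>
     (\<forall>\<^sub>F t in nhds 0.
        \<eta> (\<phi> (\<gamma> t)) \<noteq> 0 \<and>
        differential (U,\<phi>) f (\<gamma> t) (\<eta> (\<phi> (\<gamma> t))) = 0 \<and>
        positive_pair (vector_derivative (\<phi> \<circ> \<gamma>) (at t)) (\<eta> (\<phi> (\<gamma> t)))))"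

definition directional_derivative ::
  "(real^2 \<Rightarrow> real^2) \<Rightarrow> (real^2 \<Rightarrow> real^3) \<Rightarrow> real^2 \<Rightarrow> real^3" where
  "directional_derivative \<eta> g = (\<lambda>x. frechet_derivative g (at x) (\<eta> x))"

definition cuspidal_edge_curvature ::
  "('a \<Rightarrow> real^3) \<Rightarrow> (real \<Rightarrow> 'a) \<Rightarrow> 'a chart2 \<Rightarrow> (real^2 \<Rightarrow> real^2) \<Rightarrow> real \<Rightarrow> real" where
  "cuspidal_edge_curvature = (\<lambda>f \<gamma> (U,\<phi>) \<eta> t.
     (let g = f \<circ> inv_into U \<phi>;
          \<gamma>' = vector_derivative (f \<circ> \<gamma>) (at t);
          f2 = (directional_derivative \<eta> ^^ 2) g (\<phi> (\<gamma> t));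
          f3 = (directional_derivative \<eta> ^^ 3) g (\<phi> (\<gamma> t))
      in norm \<gamma>' powr (3/2) * det (vector [\<gamma>', f2, f3] :: real^3^3)
           / norm (cross3 \<gamma>' f2) powr (5/2)))"


section \<open>Plane cusps\<close>

definition curve_derivative :: "(real \<Rightarrow> real^2) \<Rightarrow> real \<Rightarrow> real^2" where
  "curve_derivative s = (\<lambda>t. vector_derivative s (at t))"

definition three_half_cusp :: "(real \<Rightarrow> real^2) \<Rightarrow> bool" where
  "three_half_cusp s \<longleftrightarrow>
     (\<exists>\<epsilon>>0. smooth_on {-\<epsilon><..<\<epsilon>} s) \<and>
     curve_derivative s 0 = 0 \<and>
     det (vector [(curve_derivative ^^ 2) s 0, (curve_derivative ^^ 3) s 0] :: real^2^2) \<noteq> 0"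

definition plane_cuspidal_curvature :: "(real \<Rightarrow> real^2) \<Rightarrow> real" where
  "plane_cuspidal_curvature s =
     det (vector [(curve_derivative ^^ 2) s 0, (curve_derivative ^^ 3) s 0] :: real^2^2)
       / norm ((curve_derivative ^^ 2) s 0) powr (5/2)"


section \<open>The oriented normal plane\<close>

definition plane_through :: "real^3 \<Rightarrow> real^3 \<Rightarrow> (real^3) set" where
  "plane_through o' n = {x. (x - o') \<bullet> n = 0}"

text \<open>Positive orthonormal bases of the direction plane \<open>n\<^sup>\<bottom>\<close>, oriented by \<open>n\<close>.\<close>

definition positive_orthonormal_basis :: "real^3 \<Rightarrow> real^3 \<Rightarrow> real^3 \<Rightarrow> bool" where
  "positive_orthonormal_basis n e1 e2 \<longleftrightarrow>
     norm e1 = 1 \<and> norm e2 = 1 \<and> e1 \<bullet> e2 = 0 \<and> e1 \<bullet> n = 0 \<and> e2 \<bullet> n = 0 \<and>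
     det (vector [n, e1, e2] :: real^3^3) > 0"

text \<open>
  Coordinates in the plane through \<open>o'\<close> with orthonormal direction basis \<open>e1, e2\<close>. They turn a
  curve in that plane into a curve in \<open>real^2\<close>.
\<close>

definition plane_coords :: "real^3 \<Rightarrow> real^3 \<Rightarrow> real^3 \<Rightarrow> real^3 \<Rightarrow> real^2" where
  "plane_coords o' e1 e2 x = vector [(x - o') \<bullet> e1, (x - o') \<bullet> e2]"

text \<open>Regular curves \<open>c\<close> on the surface for which \<open>f \<circ> c\<close> is an admissible parametrization of
  the section by \<open>P\<close>.\<close>

definition section_curve ::
  "'a::{t2_space,second_countable_topology} set \<Rightarrow> 'a chart2 set \<Rightarrow> ('a \<Rightarrow> real^3) \<Rightarrow>
     (real \<Rightarrow> 'a) \<Rightarrow> (real^3) set \<Rightarrow> real set \<Rightarrow> (real \<Rightarrow> 'a) \<Rightarrow> bool" where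
  "section_curve M \<A> f \<gamma> P J c \<longleftrightarrow>
     regular_curve M \<A> J c \<and> 0 \<in> J \<and> c 0 = \<gamma> 0 \<and>
     positively_oriented_curves \<A> \<gamma> c \<and> (f \<circ> c) ` J \<subseteq> P"

end

theory Submission
  imports Defs
begin

text \<open>
  In adapted coordinates \<open>(u, v)\<close> the map is \<open>f = G(u, v\<^sup>2, v\<^sup>3)\<close> with a local diffeomorphism \<open>G\<close>,
  and the singular curve is \<open>v = 0\<close>. Both the velocity of a section curve and the null vector at
  \<open>p\<close> annihilate \<open>(u, v\<^sup>2, v\<^sup>3)\<close> to first order, so in the second and third derivatives of \<open>f\<close>
  in these directions only \<open>L = dG(0)\<close> survives: they are \<open>L(_, 2b\<^sup>2, 0)\<close> and \<open>L(_, _, 6b\<^sup>3)\<close>,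
  where \<open>b\<close> is the \<open>v\<close>-component of the direction. Since the tangent of the singular curve is a
  multiple of \<open>L(1, 0, 0)\<close>, the entries marked \<open>_\<close> drop out of both curvatures, which are then
  homogeneous of degree 0 in \<open>b\<close>; orientation gives \<open>b\<close> the same sign in both cases. The
  section itself is a curve over the \<open>v\<close>-axis by the implicit function theorem.
\<close>

section \<open>Calculus of smooth maps\<close>

text \<open>The target diffeomorphism \<open>G\<close> respects neither lengths nor angles, so the
  normal form does not give either curvature by itself; what it gives is their comparison. Let
  \<open>b\<close> and \<open>\<beta>\<close> be the \<open>v\<close>-components of the section
  velocity and of the null vector, and \<open>r = b / \<beta>\<close>. Modulo the tangent direction
  \<open>n\<close>, passing from the null field to the section multiplies the determinants by
  \<open>r ^ 5\<close> and the cross products by \<open>r\<^sup>2\<close>, and the power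
  \<open>5/2\<close> in both denominators balances these exactly when \<open>r > 0\<close>. The
  adapted coordinates may reverse orientation. This is harmless, because \<open>a * b\<close> and
  \<open>a * \<beta>\<close> arise from two positive determinants through the same Jacobian factor,
  which enters their product squared. The plane \<open>P\<close> is transversal to the edge because
  \<open>n\<close> is \<open>L (a, 0, 0)\<close>: the equation of \<open>P\<close> has
  \<open>u\<close>-derivative \<open>(n \<bullet> n) / a\<close> at the origin. The inverse function
  theorem yields a curve that is only known to be differentiable; differentiating its two defining
  equations shows that it solves an autonomous equation with smooth right-hand side.\<close>

lemma frechet_derivative_apply:
  "(f has_derivative D) (at x) \<Longrightarrow> frechet_derivative f (at x) v = D v"
  using frechet_derivative_at by metis

text \<open>Openness of \<open>S\<close> matters: \<open>frechet_derivative\<close> at a point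
  depends on the values near it, and agreement on \<open>S\<close> controls these only if
  \<open>S\<close> is open. The rules below use this to replace a derivative by its closed
  formula.\<close>

lemma Ck_on_cong:
  assumes "open S" "\<And>x. x \<in> S \<Longrightarrow> f x = g x" "Ck_on n S f"
  shows "Ck_on n S g"
  using assms(2,3)
proof (induction n arbitrary: f g)
  case 0
  then show ?case by (auto intro: continuous_on_eq)
next
  case (Suc n)
  have eq: "frechet_derivative f (at x) = frechet_derivative g (at x)" if "x \<in> S" for x
    using frechet_derivative_transform_within_open[of f x S g] Suc.prems that \<open>open S\<close> by auto
  have "g differentiable (at x)" if "x \<in> S" for x
  proof -
    have "f differentiable (at x)"
      using Suc.prems(2) that by simp
    then obtain D where "(f has_derivative D) (at x)"
      unfolding differentiable_def ..
    then have "(g has_derivative D) (at x)"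
      by (rule has_derivative_transform_within_open[OF _ \<open>open S\<close> that]) (rule Suc.prems(1))
    then show ?thesis
      by (rule differentiableI)
  qed
  moreover have "Ck_on n S (\<lambda>x. frechet_derivative g (at x) v)" for v
    by (rule Suc.IH[of "\<lambda>x. frechet_derivative f (at x) v"]) (use Suc.prems(2) eq in simp_all)
  ultimately show ?case by simp
qed

lemma Ck_on_subset: "Ck_on n S f \<Longrightarrow> T \<subseteq> S \<Longrightarrow> Ck_on n T f"
  by (induction n arbitrary: f) (auto intro: continuous_on_subset)

text \<open>The recursion does not mention lower orders: \<open>Ck_on (Suc n)\<close> asks for
  differentiability and for directional derivatives of order \<open>n\<close>. The descent ends
  where differentiability implies continuity.\<close>

lemma Ck_on_Suc_imp: "Ck_on (Suc n) S f \<Longrightarrow> Ck_on n S f"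
proof (induction n arbitrary: f)
  case 0
  then show ?case
    by (auto intro!: continuous_at_imp_continuous_on differentiable_imp_continuous_within)
next
  case (Suc n)
  then show ?case by (metis Ck_on.simps(2))
qed

lemma Ck_on_imp_continuous_on: "Ck_on n S f \<Longrightarrow> continuous_on S f"
proof (induction n)
  case (Suc n)
  then show ?case using Ck_on_Suc_imp by blast
qed simp

lemma Ck_on_const: "Ck_on n S (\<lambda>x. c)"
  by (induction n arbitrary: c) (auto simp: frechet_derivative_const)

lemma Ck_on_id: "Ck_on n S (\<lambda>x. x)"
  by (cases n) (auto simp: Ck_on_const frechet_derivative_ident)

lemma Ck_on_linear:
  assumes "bounded_linear L" "open S" "Ck_on n S f"
  shows "Ck_on n S (\<lambda>x. L (f x))"
  using assms(3)
proof (induction n arbitrary: f)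
  case 0
  then show ?case using assms(1) by (auto intro: bounded_linear.continuous_on)
next
  case (Suc n)
  have d: "((\<lambda>x. L (f x)) has_derivative (\<lambda>v. L (frechet_derivative f (at x) v))) (at x)"
    if "x \<in> S" for x
    using Suc.prems that bounded_linear.has_derivative[OF assms(1)] frechet_derivative_works
    by fastforce
  have "Ck_on n S (\<lambda>x. frechet_derivative (\<lambda>x. L (f x)) (at x) v)" for v
  proof (rule Ck_on_cong[OF \<open>open S\<close>])
    show "Ck_on n S (\<lambda>x. L (frechet_derivative f (at x) v))"
      using Suc.prems by (intro Suc.IH) auto
  qed (simp add: frechet_derivative_apply[OF d])
  then show ?case using d by (auto simp: differentiable_def)
qed

lemma Ck_on_add:
  assumes "open S" "Ck_on n S f" "Ck_on n S g"
  shows "Ck_on n S (\<lambda>x. f x + g x)"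
  using assms(2,3)
proof (induction n arbitrary: f g)
  case 0
  then show ?case by (auto intro: continuous_intros)
next
  case (Suc n)
  have d: "((\<lambda>x. f x + g x) has_derivative
      (\<lambda>v. frechet_derivative f (at x) v + frechet_derivative g (at x) v)) (at x)"
    if "x \<in> S" for x
    using Suc.prems that by (intro has_derivative_add) (auto simp flip: frechet_derivative_works)
  have "Ck_on n S (\<lambda>x. frechet_derivative (\<lambda>x. f x + g x) (at x) v)" for v
  proof (rule Ck_on_cong[OF \<open>open S\<close>])
    show "Ck_on n S (\<lambda>x. frechet_derivative f (at x) v + frechet_derivative g (at x) v)"
      using Suc.prems by (intro Suc.IH) auto
  qed (simp add: frechet_derivative_apply[OF d])
  then show ?case using d by (auto simp: differentiable_def)
qed

lemma Ck_on_sum: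
  assumes "open S" "finite I" "\<And>i. i \<in> I \<Longrightarrow> Ck_on n S (f i)"
  shows "Ck_on n S (\<lambda>x. \<Sum>i\<in>I. f i x)"
  using assms(2,3) by (induction I rule: finite_induct) (auto simp: Ck_on_const Ck_on_add[OF assms(1)])

text \<open>Each Leibniz term leaves one factor undifferentiated, so the induction step needs both
  functions at the lower order as well.\<close>

lemma Ck_on_bilinear:
  assumes "bounded_bilinear B" "open S" "Ck_on n S f" "Ck_on n S g"
  shows "Ck_on n S (\<lambda>x. B (f x) (g x))"
  using assms(3,4)
proof (induction n arbitrary: f g)
  case 0
  then show ?case using assms(1) by (auto intro: bounded_bilinear.continuous_on)
next
  case (Suc n)
  have d: "((\<lambda>x. B (f x) (g x)) has_derivative
      (\<lambda>v. B (f x) (frechet_derivative g (at x) v) + B (frechet_derivative f (at x) v) (g x))) (at x)"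
    if "x \<in> S" for x
    using Suc.prems that
    by (intro bounded_bilinear.FDERIV[OF assms(1)]) (auto simp flip: frechet_derivative_works)
  have "Ck_on n S (\<lambda>x. frechet_derivative (\<lambda>x. B (f x) (g x)) (at x) v)" for v
  proof (rule Ck_on_cong[OF \<open>open S\<close>])
    show "Ck_on n S (\<lambda>x. B (f x) (frechet_derivative g (at x) v) + B (frechet_derivative f (at x) v) (g x))"
      using Suc.prems Suc.prems[THEN Ck_on_Suc_imp]
      by (intro Ck_on_add[OF \<open>open S\<close>] Suc.IH) auto
  qed (simp add: frechet_derivative_apply[OF d])
  then show ?case using d by (auto simp: differentiable_def)
qed

text \<open>\<open>Ck_on\<close> controls derivatives in fixed directions only. Over
  \<open>Basis\<close>, a derivative in a moving direction becomes a finite sum of scalar functions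
  times derivatives in fixed directions, and the rules for sums and products apply.\<close>

lemma euclidean_linear_expansion:
  fixes L :: "'a::euclidean_space \<Rightarrow> 'b::real_vector"
  assumes "linear L"
  shows "L v = (\<Sum>b\<in>Basis. (v \<bullet> b) *\<^sub>R L b)"
  by (metis (no_types, lifting) assms euclidean_representation linear_scale linear_sum sum.cong)

lemma frechet_derivative_comp_expansion:
  fixes f :: "'a::euclidean_space \<Rightarrow> 'b::euclidean_space" and g :: "'b \<Rightarrow> 'c::euclidean_space"
  assumes "f differentiable (at x)" "g differentiable (at (f x))"
  shows "frechet_derivative (\<lambda>x. g (f x)) (at x) v =
    (\<Sum>b\<in>Basis. (frechet_derivative f (at x) v \<bullet> b) *\<^sub>R frechet_derivative g (at (f x)) b)"
proof -
  have "frechet_derivative (\<lambda>x. g (f x)) (at x) v =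
      frechet_derivative g (at (f x)) (frechet_derivative f (at x) v)"
    using frechet_derivative_compose[OF assms] unfolding o_def by (rule fun_cong)
  also have "\<dots> = (\<Sum>b\<in>Basis. (frechet_derivative f (at x) v \<bullet> b) *\<^sub>R
      frechet_derivative g (at (f x)) b)"
    by (rule euclidean_linear_expansion[OF linear_frechet_derivative[OF assms(2)]])
  finally show ?thesis .
qed

text \<open>The chain rule enters in expanded form because the inner direction
  \<open>frechet_derivative f (at x) v\<close> moves with \<open>x\<close>. Only \<open>g\<close> is
  generalised in the induction: its partial derivatives take its place while \<open>f\<close>
  stays.\<close>

lemma Ck_on_compose:
  fixes f :: "'a::euclidean_space \<Rightarrow> 'b::euclidean_space" and g :: "'b \<Rightarrow> 'c::euclidean_space"
  assumes "open S" "open T" "f ` S \<subseteq> T" "Ck_on n S f" "Ck_on n T g"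
  shows "Ck_on n S (\<lambda>x. g (f x))"
  using assms(4,5)
proof (induction n arbitrary: g)
  case 0
  then show ?case using assms(3) by (auto intro: continuous_on_compose2)
next
  case (Suc n)
  have fd: "f differentiable (at x)" and gd: "g differentiable (at (f x))" if "x \<in> S" for x
    using Suc.prems that assms(3) by auto
  have "Ck_on n S (\<lambda>x. frechet_derivative (\<lambda>x. g (f x)) (at x) v)" for v
  proof (rule Ck_on_cong[OF \<open>open S\<close>])
    show "Ck_on n S (\<lambda>x. \<Sum>b\<in>Basis. (frechet_derivative f (at x) v \<bullet> b) *\<^sub>R
        frechet_derivative g (at (f x)) b)"
    proof (intro Ck_on_sum[OF \<open>open S\<close>] Ck_on_bilinear[OF bounded_bilinear_scaleR \<open>open S\<close>])
      show "Ck_on n S (\<lambda>x. frechet_derivative f (at x) v \<bullet> b)" for b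
        using Suc.prems by (intro Ck_on_linear[OF bounded_linear_inner_left \<open>open S\<close>]) auto
      show "Ck_on n S (\<lambda>x. frechet_derivative g (at (f x)) b)" for b
        using Suc.prems by (intro Suc.IH Ck_on_Suc_imp[of n S f]) auto
    qed simp
  qed (use frechet_derivative_comp_expansion[OF fd gd] in simp)
  moreover have "(\<lambda>x. g (f x)) differentiable (at x)" if "x \<in> S" for x
    using differentiable_chain_at[OF fd gd] that by (simp add: o_def)
  ultimately show ?case by simp
qed

text \<open>The derivative of the reciprocal is a product of the reciprocal itself with the
  derivative of \<open>f\<close>, so the induction hypothesis for the same \<open>f\<close> is
  enough.\<close>

lemma Ck_on_inverse:
  fixes f :: "'a::euclidean_space \<Rightarrow> real"
  assumes "open S" "\<And>x. x \<in> S \<Longrightarrow> f x \<noteq> 0" "Ck_on n S f"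
  shows "Ck_on n S (\<lambda>x. inverse (f x))"
  using assms(3)
proof (induction n)
  case 0
  then show ?case using assms(2) by (auto intro!: continuous_intros)
next
  case (Suc n)
  have d: "((\<lambda>x. inverse (f x)) has_derivative
      (\<lambda>v. - (inverse (f x) * frechet_derivative f (at x) v * inverse (f x)))) (at x)"
    if "x \<in> S" for x
    using Suc.prems that assms(2)
    by (intro Deriv.has_derivative_inverse) (auto simp flip: frechet_derivative_works)
  have IH: "Ck_on n S (\<lambda>x. inverse (f x))"
    using Suc Ck_on_Suc_imp by blast
  have "Ck_on n S (\<lambda>x. frechet_derivative (\<lambda>x. inverse (f x)) (at x) v)" for v
  proof (rule Ck_on_cong[OF \<open>open S\<close>])
    show "Ck_on n S (\<lambda>x. - (inverse (f x) * frechet_derivative f (at x) v * inverse (f x)))"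
      using Suc.prems IH
      by (intro Ck_on_linear[OF bounded_linear_minus[OF bounded_linear_ident] \<open>open S\<close>]
          Ck_on_bilinear[OF bounded_bilinear_mult \<open>open S\<close>]) auto
  qed (simp add: frechet_derivative_apply[OF d])
  then show ?case using d by (auto simp: differentiable_def)
qed

lemma smooth_on_cong: "open S \<Longrightarrow> (\<And>x. x \<in> S \<Longrightarrow> f x = g x) \<Longrightarrow> smooth_on S f \<Longrightarrow> smooth_on S g"
  unfolding smooth_on_def using Ck_on_cong by blast

lemma smooth_on_subset: "smooth_on S f \<Longrightarrow> T \<subseteq> S \<Longrightarrow> smooth_on T f"
  unfolding smooth_on_def using Ck_on_subset by blast

lemma smooth_on_imp_continuous_on: "smooth_on S f \<Longrightarrow> continuous_on S f"
  unfolding smooth_on_def using Ck_on_imp_continuous_on by blast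

lemma smooth_on_imp_differentiable: "smooth_on S f \<Longrightarrow> x \<in> S \<Longrightarrow> f differentiable (at x)"
  unfolding smooth_on_def by (metis Ck_on.simps(2))

lemma smooth_on_has_derivative:
  "smooth_on S f \<Longrightarrow> x \<in> S \<Longrightarrow> (f has_derivative frechet_derivative f (at x)) (at x)"
  using smooth_on_imp_differentiable frechet_derivative_works by blast

lemma smooth_on_frechet: "smooth_on S f \<Longrightarrow> smooth_on S (\<lambda>x. frechet_derivative f (at x) v)"
  unfolding smooth_on_def by (metis Ck_on.simps(2))

lemma smooth_on_const: "smooth_on S (\<lambda>x. c)"
  and smooth_on_id: "smooth_on S (\<lambda>x. x)"
  unfolding smooth_on_def using Ck_on_const Ck_on_id by blast+

lemma smooth_on_linear: "bounded_linear L \<Longrightarrow> open S \<Longrightarrow> smooth_on S f \<Longrightarrow> smooth_on S (\<lambda>x. L (f x))"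
  unfolding smooth_on_def using Ck_on_linear by blast

lemma smooth_on_inner_left: "open S \<Longrightarrow> smooth_on S f \<Longrightarrow> smooth_on S (\<lambda>x. f x \<bullet> c)"
  by (rule smooth_on_linear[OF bounded_linear_inner_left])

lemma smooth_on_nth: "open S \<Longrightarrow> smooth_on S f \<Longrightarrow> smooth_on S (\<lambda>x. (f x :: real^'n) $ i)"
  by (rule smooth_on_linear[OF bounded_linear_vec_nth])

lemma smooth_on_add: "open S \<Longrightarrow> smooth_on S f \<Longrightarrow> smooth_on S g \<Longrightarrow> smooth_on S (\<lambda>x. f x + g x)"
  unfolding smooth_on_def using Ck_on_add by blast

lemma smooth_on_sum:
  "open S \<Longrightarrow> finite I \<Longrightarrow> (\<And>i. i \<in> I \<Longrightarrow> smooth_on S (f i)) \<Longrightarrow> smooth_on S (\<lambda>x. \<Sum>i\<in>I. f i x)"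
  unfolding smooth_on_def using Ck_on_sum by blast

lemma smooth_on_scaleR:
  "open S \<Longrightarrow> smooth_on S f \<Longrightarrow> smooth_on S g \<Longrightarrow> smooth_on S (\<lambda>x. f x *\<^sub>R g x)"
  unfolding smooth_on_def using Ck_on_bilinear[OF bounded_bilinear_scaleR] by blast

lemma smooth_on_mult:
  "open S \<Longrightarrow> smooth_on S f \<Longrightarrow> smooth_on S g \<Longrightarrow> smooth_on S (\<lambda>x. f x * g x :: real)"
  using smooth_on_scaleR[of S f g] by simp

lemma smooth_on_inverse:
  fixes f :: "'a::euclidean_space \<Rightarrow> real"
  shows "open S \<Longrightarrow> (\<And>x. x \<in> S \<Longrightarrow> f x \<noteq> 0) \<Longrightarrow> smooth_on S f \<Longrightarrow> smooth_on S (\<lambda>x. inverse (f x))"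
  unfolding smooth_on_def using Ck_on_inverse by blast

lemma smooth_on_compose:
  "open S \<Longrightarrow> open T \<Longrightarrow> f ` S \<subseteq> T \<Longrightarrow> smooth_on S f \<Longrightarrow> smooth_on T g \<Longrightarrow> smooth_on S (\<lambda>x. g (f x))"
  unfolding smooth_on_def using Ck_on_compose by blast

lemma smooth_on_vec:
  fixes f :: "'a::euclidean_space \<Rightarrow> real^'n"
  assumes "open S" "\<And>i. smooth_on S (\<lambda>x. f x $ i)"
  shows "smooth_on S f"
proof -
  have "f = (\<lambda>x. \<Sum>i\<in>UNIV. (f x $ i) *\<^sub>R axis i 1)"
    by (simp add: fun_eq_iff vec_eq_iff sum_component axis_def if_distrib cong: if_cong)
  moreover have "smooth_on S (\<lambda>x. \<Sum>i\<in>UNIV. (f x $ i) *\<^sub>R axis i (1::real))"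
    using assms by (intro smooth_on_sum smooth_on_scaleR smooth_on_const) auto
  ultimately show ?thesis by simp
qed

lemma frechet_derivative_left_inverse:
  assumes "open S" "x \<in> S" "f differentiable (at x)" "g differentiable (at (f x))"
    and "\<And>y. y \<in> S \<Longrightarrow> g (f y) = y"
  shows "frechet_derivative g (at (f x)) (frechet_derivative f (at x) v) = v"
proof -
  have "(g \<circ> f has_derivative (\<lambda>v. v)) (at x)"
    by (rule has_derivative_transform_within_open[OF has_derivative_ident assms(1,2)])
      (simp add: assms(5))
  then have "frechet_derivative (g \<circ> f) (at x) v = v"
    by (rule frechet_derivative_apply)
  then show ?thesis
    by (simp add: frechet_derivative_compose[OF assms(3,4)])
qed

section \<open>Derivatives along a vector field\<close>

text \<open>This is \<open>directional_derivative\<close> freed from its fixed dimensions. With the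
  constant field \<open>1\<close> on the line it is the parameter derivative of a curve, so that
  section curves and null vector fields obey the same rules.\<close>

definition along :: "('a::euclidean_space \<Rightarrow> 'a) \<Rightarrow> ('a \<Rightarrow> 'b::euclidean_space) \<Rightarrow> 'a \<Rightarrow> 'b" where
  "along \<eta> f = (\<lambda>x. frechet_derivative f (at x) (\<eta> x))"

lemma along_eqI: "(f has_derivative f') (at x) \<Longrightarrow> along \<eta> f x = f' (\<eta> x)"
  unfolding along_def using frechet_derivative_at by metis

lemma along_cong:
  assumes "open S" "x \<in> S" "smooth_on S f" "\<And>x. x \<in> S \<Longrightarrow> f x = g x"
  shows "along \<eta> g x = along \<eta> f x"
  using frechet_derivative_transform_within_open[of f x S g] smooth_on_imp_differentiable assms
  by (metis along_def)

lemma smooth_on_along: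
  assumes "open S" "smooth_on S \<eta>" "smooth_on S f"
  shows "smooth_on S (along \<eta> f)"
proof (rule smooth_on_cong[OF assms(1)])
  show "smooth_on S (\<lambda>x. \<Sum>b\<in>Basis. (\<eta> x \<bullet> b) *\<^sub>R frechet_derivative f (at x) b)"
    using assms by (intro smooth_on_sum smooth_on_scaleR smooth_on_inner_left smooth_on_frechet) auto
  show "(\<Sum>b\<in>Basis. (\<eta> x \<bullet> b) *\<^sub>R frechet_derivative f (at x) b) = along \<eta> f x" if "x \<in> S" for x
    unfolding along_def using euclidean_linear_expansion linear_frechet_derivative smooth_on_imp_differentiable
      assms(3) that by metis
qed

lemma smooth_on_along_power:
  assumes "open S" "smooth_on S \<eta>" "smooth_on S f"
  shows "smooth_on S ((along \<eta> ^^ k) f)"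
  using assms by (induction k) (auto intro: smooth_on_along)

lemma along_power_cong:
  assumes "open S" "smooth_on S \<eta>" "smooth_on S f" "\<And>x. x \<in> S \<Longrightarrow> f x = g x" "x \<in> S"
  shows "(along \<eta> ^^ k) g x = (along \<eta> ^^ k) f x"
  using assms(5)
proof (induction k arbitrary: x)
  case 0
  then show ?case using assms(4) by simp
next
  case (Suc k)
  have "along \<eta> ((along \<eta> ^^ k) g) x = along \<eta> ((along \<eta> ^^ k) f) x"
    by (rule along_cong[OF assms(1) Suc.prems smooth_on_along_power[OF assms(1,2,3)] Suc.IH[symmetric]])
  then show ?case by simp
qed

lemma along_linear:
  assumes "bounded_linear L" "smooth_on S f" "x \<in> S"
  shows "along \<eta> (\<lambda>x. L (f x)) x = L (along \<eta> f x)"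
  unfolding along_def
  by (subst frechet_derivative_apply[OF bounded_linear.has_derivative[OF assms(1) smooth_on_has_derivative[OF assms(2,3)]]], simp)

lemma along_power_linear:
  assumes "bounded_linear L" "open S" "smooth_on S \<eta>" "smooth_on S f" "x \<in> S"
  shows "(along \<eta> ^^ k) (\<lambda>x. L (f x)) x = L ((along \<eta> ^^ k) f x)"
  using assms(5)
proof (induction k arbitrary: x)
  case (Suc k)
  have "along \<eta> ((along \<eta> ^^ k) (\<lambda>x. L (f x))) x = along \<eta> (\<lambda>x. L ((along \<eta> ^^ k) f x)) x"
    using Suc assms smooth_on_along_power
    by (intro along_cong[OF assms(2)] smooth_on_linear[OF assms(1,2)]) auto
  then show ?case
    using along_linear[OF assms(1) smooth_on_along_power[OF assms(2,3,4)] Suc.prems] by simp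
qed simp

lemma along_const [simp]: "along \<eta> (\<lambda>x. c) = (\<lambda>x. 0)"
  by (simp add: along_def fun_eq_iff)

lemma along_id: "along \<eta> (\<lambda>x. x) x = \<eta> x"
  by (simp add: along_def frechet_derivative_ident)

lemma along_sum:
  assumes "finite I" "\<And>i. i \<in> I \<Longrightarrow> smooth_on S (f i)" "x \<in> S"
  shows "along \<eta> (\<lambda>x. \<Sum>i\<in>I. f i x) x = (\<Sum>i\<in>I. along \<eta> (f i) x)"
proof -
  have "((\<lambda>x. \<Sum>i\<in>I. f i x) has_derivative (\<lambda>v. \<Sum>i\<in>I. frechet_derivative (f i) (at x) v)) (at x)"
    by (rule has_derivative_sum) (rule smooth_on_has_derivative[OF assms(2,3)])
  then show ?thesis
    unfolding along_def by (rule frechet_derivative_apply)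
qed

lemma along_add:
  assumes "smooth_on S f" "smooth_on S g" "x \<in> S"
  shows "along \<eta> (\<lambda>x. f x + g x) x = along \<eta> f x + along \<eta> g x"
  unfolding along_def
  by (subst frechet_derivative_apply[OF has_derivative_add[OF assms(1,2)[THEN smooth_on_has_derivative, OF assms(3)]]], simp)

lemma along_scaleR:
  assumes "smooth_on S f" "smooth_on S g" "x \<in> S"
  shows "along \<eta> (\<lambda>x. f x *\<^sub>R g x) x = f x *\<^sub>R along \<eta> g x + along \<eta> f x *\<^sub>R g x"
  unfolding along_def
  by (subst frechet_derivative_apply[OF has_derivative_scaleR[OF assms(1,2)[THEN smooth_on_has_derivative, OF assms(3)]]], simp)

lemma along_compose:
  assumes "smooth_on S f" "smooth_on T g" "x \<in> S" "f x \<in> T"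
  shows "along \<eta> (\<lambda>x. g (f x)) x = frechet_derivative g (at (f x)) (along \<eta> f x)"
  unfolding along_def
  using frechet_derivative_apply[OF diff_chain_at[OF smooth_on_has_derivative[OF assms(1,3)]
        smooth_on_has_derivative[OF assms(2,4)]], of "\<eta> x"]
  unfolding o_def .

text \<open>Where the first derivative of \<open>Z\<close> vanishes, all terms of the second and third derivatives
  of \<open>G \<circ> Z\<close> that involve higher derivatives of \<open>G\<close> contain that factor.\<close>

lemma
  fixes Z :: "'a::euclidean_space \<Rightarrow> 'b::euclidean_space" and G :: "'b \<Rightarrow> 'c::euclidean_space"
  assumes "open S" "open D" "smooth_on S \<eta>" "smooth_on S Z" "smooth_on D G" "Z ` S \<subseteq> D"
    and "x \<in> S" "along \<eta> Z x = 0"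
  shows along2_compose: "along \<eta> (along \<eta> (\<lambda>x. G (Z x))) x =
      frechet_derivative G (at (Z x)) (along \<eta> (along \<eta> Z) x)" (is ?thesis2)
    and along3_compose: "along \<eta> (along \<eta> (along \<eta> (\<lambda>x. G (Z x)))) x =
      frechet_derivative G (at (Z x)) (along \<eta> (along \<eta> (along \<eta> Z)) x)" (is ?thesis3)
proof -
  \<comment> \<open>\<open>q b\<close> is a partial derivative of \<open>G\<close> taken at
    \<open>Z y\<close>, and \<open>p b\<close> a component of the \<open>\<eta>\<close>-derivative
    of \<open>Z\<close>. The chain rule is the sum of \<open>p b y *\<^sub>R q b y\<close>, which is
    then differentiated by the Leibniz rule.\<close>
  define q where "q b y = frechet_derivative G (at (Z y)) b" for b y
  define p where "p b y = along \<eta> Z y \<bullet> b" for b y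
  note a = smooth_on_along[OF \<open>open S\<close> assms(3)]
  have sq: "smooth_on S (q b)" for b
    unfolding q_def
    by (rule smooth_on_compose[OF assms(1,2,6,4) smooth_on_frechet[OF assms(5)]])
  have sp: "smooth_on S (p b)" for b
    unfolding p_def using a assms by (intro smooth_on_inner_left)
  have exp: "frechet_derivative G (at (Z y)) v = (\<Sum>b\<in>Basis. (v \<bullet> b) *\<^sub>R q b y)" if "y \<in> S" for y v
    unfolding q_def using assms that
    by (intro euclidean_linear_expansion linear_frechet_derivative smooth_on_imp_differentiable[of D]) auto
  have p0: "p b x = 0" for b
    using assms by (simp add: p_def)
  \<comment> \<open>Differentiating \<open>q b\<close> produces the differential of a partial
    derivative of \<open>G\<close>, applied to the vanishing first derivative of
    \<open>Z\<close>.\<close>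
  have q0: "along \<eta> (q b) x = 0" for b
    unfolding q_def using along_compose[OF assms(4) smooth_on_frechet[OF assms(5)], of x \<eta> b] assms
    by (simp add: image_subset_iff linear_0[OF linear_frechet_derivative]
        smooth_on_imp_differentiable[OF smooth_on_frechet[OF assms(5)]])
  have p1: "along \<eta> (p b) y = along \<eta> (along \<eta> Z) y \<bullet> b" if "y \<in> S" for b y
    unfolding p_def using along_linear[OF bounded_linear_inner_left a[OF assms(4)] that] .
  have p2: "along \<eta> (along \<eta> (p b)) y = along \<eta> (along \<eta> (along \<eta> Z)) y \<bullet> b" if "y \<in> S" for b y
    using along_power_linear[OF bounded_linear_inner_left assms(1,3) a[OF assms(4)] that, of 2 b]
    by (simp add: p_def[abs_def] eval_nat_numeral)
  have sG: "smooth_on S (\<lambda>x. G (Z x))"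
    by (rule smooth_on_compose[OF assms(1,2,6,4,5)])
  have e1: "(\<Sum>b\<in>Basis. p b y *\<^sub>R q b y) = along \<eta> (\<lambda>x. G (Z x)) y" if "y \<in> S" for y
    using along_compose[OF assms(4,5) that] that assms(6) exp[OF that] by (auto simp: p_def)
  have s1: "smooth_on S (\<lambda>y. \<Sum>b\<in>Basis. p b y *\<^sub>R q b y)"
    using sp sq assms(1) by (intro smooth_on_sum smooth_on_scaleR) auto
  have e2: "(\<Sum>b\<in>Basis. p b y *\<^sub>R along \<eta> (q b) y + along \<eta> (p b) y *\<^sub>R q b y)
      = along \<eta> (along \<eta> (\<lambda>x. G (Z x))) y" if "y \<in> S" for y
  proof -
    have "along \<eta> (along \<eta> (\<lambda>x. G (Z x))) y = along \<eta> (\<lambda>y. \<Sum>b\<in>Basis. p b y *\<^sub>R q b y) y"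
      using along_cong[OF assms(1) that s1 e1] .
    also have "\<dots> = (\<Sum>b\<in>Basis. along \<eta> (\<lambda>y. p b y *\<^sub>R q b y) y)"
      using that sp sq assms(1) by (intro along_sum[of _ S] smooth_on_scaleR) auto
    finally show ?thesis
      using along_scaleR[OF sp sq that] by simp
  qed
  then show ?thesis2
    using e2[OF assms(7)] p0 by (simp add: p1[OF assms(7)] exp[OF assms(7)])
  note sm = a[OF sp] a[OF sq] a[OF a[OF sp]] a[OF a[OF sq]] sp sq
  have "along \<eta> (along \<eta> (along \<eta> (\<lambda>x. G (Z x)))) x =
      along \<eta> (\<lambda>y. \<Sum>b\<in>Basis. p b y *\<^sub>R along \<eta> (q b) y + along \<eta> (p b) y *\<^sub>R q b y) x"
    using assms sm by (intro along_cong[OF assms(1) _ _ e2] smooth_on_sum smooth_on_add smooth_on_scaleR) auto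
  also have "\<dots> = (\<Sum>b\<in>Basis. along \<eta> (\<lambda>y. p b y *\<^sub>R along \<eta> (q b) y + along \<eta> (p b) y *\<^sub>R q b y) x)"
    using assms sm by (intro along_sum[of _ S] smooth_on_add smooth_on_scaleR) auto
  \<comment> \<open>Of the four Leibniz terms only the one with \<open>p b\<close> differentiated
    twice survives, since \<open>p b\<close> and the derivative of \<open>q b\<close> vanish at
    \<open>x\<close>.\<close>
  also have "\<dots> = (\<Sum>b\<in>Basis. along \<eta> (along \<eta> (p b)) x *\<^sub>R q b x)"
  proof (rule sum.cong)
    fix b
    have "along \<eta> (\<lambda>y. p b y *\<^sub>R along \<eta> (q b) y + along \<eta> (p b) y *\<^sub>R q b y) x =
       along \<eta> (\<lambda>y. p b y *\<^sub>R along \<eta> (q b) y) x + along \<eta> (\<lambda>y. along \<eta> (p b) y *\<^sub>R q b y) x"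
      using sm assms by (intro along_add[of S] smooth_on_scaleR) auto
    also have "\<dots> = along \<eta> (along \<eta> (p b)) x *\<^sub>R q b x"
      using along_scaleR[OF sp a[OF sq] assms(7)] along_scaleR[OF a[OF sp] sq assms(7)] p0 q0 by simp
    finally show "along \<eta> (\<lambda>y. p b y *\<^sub>R along \<eta> (q b) y + along \<eta> (p b) y *\<^sub>R q b y) x
        = along \<eta> (along \<eta> (p b)) x *\<^sub>R q b x" .
  qed simp
  finally show ?thesis3
    by (simp add: p2[OF assms(7)] exp[OF assms(7)])
qed

lemma along_mult:
  fixes a b :: "'a::euclidean_space \<Rightarrow> real"
  assumes "smooth_on S a" "smooth_on S b" "x \<in> S"
  shows "along \<eta> (\<lambda>x. a x * b x) x = a x * along \<eta> b x + along \<eta> a x * b x"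
  using along_scaleR[OF assms] by simp

text \<open>All derivatives are taken along one field, so the terms collect with the binomial
  coefficients 1, 2, 1 and 1, 3, 3, 1.\<close>

lemma
  fixes a b :: "'a::euclidean_space \<Rightarrow> real"
  assumes "open S" "smooth_on S \<eta>" "smooth_on S a" "smooth_on S b" "x \<in> S"
  shows along2_mult: "along \<eta> (along \<eta> (\<lambda>x. a x * b x)) x =
      a x * along \<eta> (along \<eta> b) x + 2 * along \<eta> a x * along \<eta> b x + along \<eta> (along \<eta> a) x * b x"
    and along3_mult: "along \<eta> (along \<eta> (along \<eta> (\<lambda>x. a x * b x))) x =
      a x * along \<eta> (along \<eta> (along \<eta> b)) x + 3 * along \<eta> a x * along \<eta> (along \<eta> b) x
      + 3 * along \<eta> (along \<eta> a) x * along \<eta> b x + along \<eta> (along \<eta> (along \<eta> a)) x * b x"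
proof -
  note A = smooth_on_along[OF assms(1,2)]
  note sa = assms(3) A[OF assms(3)] A[OF A[OF assms(3)]]
  note sb = assms(4) A[OF assms(4)] A[OF A[OF assms(4)]]
  note m = along_mult[OF sa(1) sb(1)] along_mult[OF sa(1) sb(2)] along_mult[OF sa(1) sb(3)]
    along_mult[OF sa(2) sb(1)] along_mult[OF sa(2) sb(2)] along_mult[OF sa(3) sb(1)]
  note sm = smooth_on_mult[OF assms(1) sa(1) sb(2)] smooth_on_mult[OF assms(1) sa(2) sb(1)]
    smooth_on_mult[OF assms(1) sa(1) sb(3)] smooth_on_mult[OF assms(1) sa(2) sb(2)]
    smooth_on_mult[OF assms(1) sa(3) sb(1)]
  have e2: "along \<eta> (along \<eta> (\<lambda>x. a x * b x)) y =
      (a y * along \<eta> (along \<eta> b) y + along \<eta> a y * along \<eta> b y) +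
      (along \<eta> a y * along \<eta> b y + along \<eta> (along \<eta> a) y * b y)" if "y \<in> S" for y
  proof -
    have "along \<eta> (along \<eta> (\<lambda>x. a x * b x)) y = along \<eta> (\<lambda>y. a y * along \<eta> b y + along \<eta> a y * b y) y"
      by (rule along_cong[OF assms(1) that smooth_on_add[OF assms(1) sm(1,2)] m(1)[symmetric]])
    then show ?thesis
      using along_add[OF sm(1,2) that] m(2,4)[OF that] by simp
  qed
  then show "along \<eta> (along \<eta> (\<lambda>x. a x * b x)) x = a x * along \<eta> (along \<eta> b) x +
      2 * along \<eta> a x * along \<eta> b x + along \<eta> (along \<eta> a) x * b x"
    using assms(5) by (simp add: algebra_simps)
  note sm' = smooth_on_add[OF assms(1) sm(3,4)] smooth_on_add[OF assms(1) sm(4,5)]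
  have "along \<eta> (along \<eta> (along \<eta> (\<lambda>x. a x * b x))) x =
     along \<eta> (\<lambda>y. (a y * along \<eta> (along \<eta> b) y + along \<eta> a y * along \<eta> b y) +
      (along \<eta> a y * along \<eta> b y + along \<eta> (along \<eta> a) y * b y)) x"
    by (rule along_cong[OF assms(1,5) smooth_on_add[OF assms(1) sm'] e2[symmetric]])
  also have "\<dots> = ((a x * along \<eta> (along \<eta> (along \<eta> b)) x + along \<eta> a x * along \<eta> (along \<eta> b) x) +
      (along \<eta> a x * along \<eta> (along \<eta> b) x + along \<eta> (along \<eta> a) x * along \<eta> b x)) +
      ((along \<eta> a x * along \<eta> (along \<eta> b) x + along \<eta> (along \<eta> a) x * along \<eta> b x) +
      (along \<eta> (along \<eta> a) x * along \<eta> b x + along \<eta> (along \<eta> (along \<eta> a)) x * b x))"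
    by (simp only: along_add[OF sm' assms(5)] along_add[OF sm(3,4) assms(5)]
      along_add[OF sm(4,5) assms(5)] m(3,5,6)[OF assms(5)])
  also have "\<dots> = a x * along \<eta> (along \<eta> (along \<eta> b)) x + 3 * along \<eta> a x * along \<eta> (along \<eta> b) x
      + 3 * along \<eta> (along \<eta> a) x * along \<eta> b x + along \<eta> (along \<eta> (along \<eta> a)) x * b x"
    by algebra
  finally show "along \<eta> (along \<eta> (along \<eta> (\<lambda>x. a x * b x))) x =
      a x * along \<eta> (along \<eta> (along \<eta> b)) x + 3 * along \<eta> a x * along \<eta> (along \<eta> b) x
      + 3 * along \<eta> (along \<eta> a) x * along \<eta> b x + along \<eta> (along \<eta> (along \<eta> a)) x * b x" .
qed

lemma curve_derivative_eq_along:
  assumes "f differentiable (at t)"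
  shows "vector_derivative f (at t) = along (\<lambda>_. 1) f t"
proof (rule vector_derivative_at)
  have d: "(f has_derivative frechet_derivative f (at t)) (at t)"
    using assms frechet_derivative_works by blast
  have "frechet_derivative f (at t) x = x *\<^sub>R frechet_derivative f (at t) 1" for x
    using linear_scale[OF linear_frechet_derivative[OF assms], of x 1]
    unfolding real_scaleR_def mult_1_right .
  then have "frechet_derivative f (at t) = (\<lambda>x. x *\<^sub>R frechet_derivative f (at t) 1)" ..
  then show "(f has_vector_derivative along (\<lambda>_. 1) f t) (at t)"
    unfolding has_vector_derivative_def along_def by (rule has_derivative_eq_rhs[OF d])
qed

lemma curve_derivative_power_eq_along:
  assumes "open S" "smooth_on S s" "t \<in> S"
  shows "(curve_derivative ^^ k) s t = (along (\<lambda>_. 1) ^^ k) s t"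
  using assms(3)
proof (induction k arbitrary: t)
  case (Suc k)
  note sm = smooth_on_along_power[OF assms(1) smooth_on_const[of S 1] assms(2), of k]
  have sm': "smooth_on S ((curve_derivative ^^ k) s)"
    by (rule smooth_on_cong[OF assms(1) Suc.IH[symmetric] sm])
  have "(curve_derivative ^^ Suc k) s t = along (\<lambda>_. 1) ((curve_derivative ^^ k) s) t"
    using curve_derivative_eq_along[OF smooth_on_imp_differentiable[OF sm' Suc.prems]]
    by (simp add: curve_derivative_def)
  also have "\<dots> = along (\<lambda>_. 1) ((along (\<lambda>_. 1) ^^ k) s) t"
    by (rule along_cong[OF assms(1) Suc.prems sm Suc.IH[symmetric]])
  finally show ?case by simp
qed simp

lemma directional_derivative_eq_along: "directional_derivative = along"
  by (simp add: fun_eq_iff directional_derivative_def along_def)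

section \<open>Smooth implicit curves\<close>

text \<open>Integral curves of a smooth vector field are smooth: the equation \<open>c' = X \<circ> c\<close> gains one
  derivative at a time.\<close>

lemma smooth_on_integral_curve:
  fixes c :: "real \<Rightarrow> 'b::euclidean_space"
  assumes "open J" "open E" "smooth_on E X" "c ` J \<subseteq> E"
    and "\<And>t. t \<in> J \<Longrightarrow> (c has_vector_derivative X (c t)) (at t)"
  shows "smooth_on J c"
  unfolding smooth_on_def
proof
  fix k
  have d: "(c has_derivative (\<lambda>v. v *\<^sub>R X (c t))) (at t)" if "t \<in> J" for t
    using assms(5)[OF that] by (simp add: has_vector_derivative_def)
  show "Ck_on k J c"
  proof (induction k)
    case 0
    then show ?case
      by (auto intro!: continuous_at_imp_continuous_on has_vector_derivative_continuous[OF assms(5)])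
  next
    case (Suc k)
    have "Ck_on k J (\<lambda>t. frechet_derivative c (at t) v)" for v
    proof (rule Ck_on_cong[OF assms(1)])
      show "Ck_on k J (\<lambda>t. v *\<^sub>R X (c t))"
        using Ck_on_compose[OF assms(1,2,4) Suc] assms(3)
        by (intro Ck_on_linear[OF bounded_linear_scaleR_right assms(1)]) (auto simp: smooth_on_def)
    qed (simp add: frechet_derivative_apply[OF d])
    then show ?case
      using d by (auto intro: differentiableI)
  qed
qed

text \<open>Applies the inverse function theorem to \<open>y \<mapsto> (h y, y $ 2)\<close>.\<close>

lemma smooth_implicit_curve:
  fixes h :: "real^2 \<Rightarrow> real"
  assumes "open E" "0 \<in> E" "smooth_on E h" "h 0 = 0" "frechet_derivative h (at 0) (axis 1 1) \<noteq> 0"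
    and s: "s = 1 \<or> s = -1"
  obtains E' \<epsilon> c where "open E'" "0 \<in> E'" "E' \<subseteq> E" "\<epsilon> > 0" "smooth_on {-\<epsilon><..<\<epsilon>} c"
    "c 0 = 0" "\<And>t. t \<in> {-\<epsilon><..<\<epsilon>} \<Longrightarrow> c t \<in> E' \<and> h (c t) = 0 \<and> c t $ 2 = s * t"
    "\<And>y. y \<in> E' \<Longrightarrow> h y = 0 \<Longrightarrow> \<bar>y $ 2\<bar> < \<epsilon> \<Longrightarrow> c (s * y $ 2) = y"
proof -
  define hu where "hu y = frechet_derivative h (at y) (axis 1 1)" for y
  define hv where "hv y = frechet_derivative h (at y) (axis 2 1)" for y
  define H where "H y = (vector [h y, y $ 2] :: real^2)" for y
  have shu: "smooth_on E hu" and shv: "smooth_on E hv"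
    unfolding hu_def hv_def by (rule smooth_on_frechet[OF assms(3)])+
  have Dh: "frechet_derivative h (at y) v = v $ 1 * hu y + v $ 2 * hv y" if "y \<in> E" for y v
  proof -
    have lin: "linear (frechet_derivative h (at y))"
      using linear_frechet_derivative smooth_on_imp_differentiable assms(3) that by blast
    have "v = (v $ 1) *\<^sub>R axis 1 1 + (v $ 2) *\<^sub>R axis 2 1"
      by (simp add: vec_eq_iff forall_2 axis_def)
    then have "frechet_derivative h (at y) v =
        frechet_derivative h (at y) ((v $ 1) *\<^sub>R axis 1 1 + (v $ 2) *\<^sub>R axis 2 1)"
      by (rule arg_cong)
    then show ?thesis
      by (simp add: hu_def hv_def linear_add[OF lin] linear_scale[OF lin])
  qed
  \<comment> \<open>On \<open>E1\<close> the \<open>u\<close>-derivative of \<open>h\<close> has no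
    zero, so its reciprocal is smooth there, as the vector field \<open>X\<close> below
    requires.\<close>
  define E1 where "E1 = E \<inter> hu -` (- {0})"
  have E1: "open E1" "0 \<in> E1" "E1 \<subseteq> E" and hu: "\<And>y. y \<in> E1 \<Longrightarrow> hu y \<noteq> 0"
    using continuous_on_open_vimage[OF assms(1), of hu] smooth_on_imp_continuous_on[OF shu] assms(2,5)
    by (auto simp: E1_def hu_def Int_commute open_Compl)
  have sH: "smooth_on E1 H"
  proof (rule smooth_on_vec[OF E1(1)])
    fix i :: 2
    show "smooth_on E1 (\<lambda>y. H y $ i)"
      using exhaust_2[of i] smooth_on_subset[OF assms(3) E1(3)] smooth_on_nth[OF E1(1) smooth_on_id]
      by (auto simp: H_def)
  qed
  define H' where "H' y = Blinfun (frechet_derivative H (at y))" for y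
  have H': "blinfun_apply (H' y) = frechet_derivative H (at y)" if "y \<in> E1" for y
    unfolding H'_def using smooth_on_has_derivative[OF sH that] has_derivative_bounded_linear
    by (intro bounded_linear_Blinfun_apply)
  have DH: "frechet_derivative H (at y) v = vector [frechet_derivative h (at y) v, v $ 2]"
    if "y \<in> E1" for y v
  proof -
    have "along (\<lambda>_. v) H y $ i = along (\<lambda>_. v) (\<lambda>y. H y $ i) y" for i
      by (rule along_linear[OF bounded_linear_vec_nth sH that, symmetric])
    moreover have "along (\<lambda>_. v) (\<lambda>y. y $ 2) y = v $ 2"
      using along_linear[OF bounded_linear_vec_nth smooth_on_id that] by (simp add: along_id)
    ultimately show ?thesis
      unfolding along_def by (simp add: vec_eq_iff forall_2 H_def)
  qed
  have "linear (blinfun_apply (H' 0))"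
    using bounded_linear.linear blinfun.bounded_linear_right by blast
  moreover have "inj (blinfun_apply (H' 0))"
  proof (rule injI)
    fix v w assume "H' 0 v = H' 0 w"
    then have "frechet_derivative h (at 0) v = frechet_derivative h (at 0) w \<and> v $ 2 = w $ 2"
      unfolding H'[OF E1(2)] DH[OF E1(2)] by (simp add: vec_eq_iff forall_2)
    then show "v = w"
      using hu[OF E1(2)] by (auto simp: Dh[OF assms(2)] vec_eq_iff forall_2)
  qed
  ultimately obtain K where K: "linear K" "K \<circ> blinfun_apply (H' 0) = id"
    using linear_injective_left_inverse by blast
  then have inv: "Blinfun K o\<^sub>L H' 0 = id_blinfun"
    by (intro blinfun_eqI)
      (simp add: bounded_linear_Blinfun_apply linear_conv_bounded_linear fun_eq_iff)
  have cont: "continuous_on E1 H'"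
  proof (rule continuous_on_blinfun_componentwise)
    fix i :: "real^2"
    show "continuous_on E1 (\<lambda>y. H' y i)"
      by (rule continuous_on_eq[OF smooth_on_imp_continuous_on[OF smooth_on_frechet[OF sH]]])
        (simp add: H')
  qed
  have der: "(H has_derivative blinfun_apply (H' y)) (at y)" if "y \<in> E1" for y
    using smooth_on_has_derivative[OF sH that] H'[OF that] by simp
  obtain E' V g g' where E': "open E'" "E' \<subseteq> E1" "0 \<in> E'" and V: "open V" "H 0 \<in> V"
    and hom: "homeomorphism E' V H g" and g: "\<And>y. y \<in> V \<Longrightarrow> (g has_derivative g' y) (at y)"
    by (rule inverse_function_theorem[OF E1(1) der cont E1(2) inv]) blast+
  have H0: "H 0 = 0"
    by (simp add: H_def assms(4) vec_eq_iff forall_2)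
  obtain \<epsilon> where \<epsilon>: "\<epsilon> > 0" "ball 0 \<epsilon> \<subseteq> V"
    using V H0 openE by metis
  let ?J = "{-\<epsilon><..<\<epsilon>}"
  \<comment> \<open>\<open>H\<close> carries zeros of \<open>h\<close> to the second axis. The
    segment \<open>l\<close> runs along this axis, backwards if \<open>s = -1\<close>, and is pulled
    back by the local inverse \<open>g\<close>.\<close>
  define l where "l t = t *\<^sub>R (axis 2 s :: real^2)" for t
  have l: "l t = vector [0, s * t]" for t
    by (simp add: l_def vec_eq_iff forall_2 axis_def)
  have "norm (l t) = \<bar>t\<bar>" for t
    using s by (auto simp: l_def norm_axis_1 norm_eq_sqrt_inner inner_axis_axis)
  then have lV: "l t \<in> V" if "t \<in> ?J" for t
    using that \<epsilon>(2) by (auto simp: subset_iff)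
  define c where "c t = g (l t)" for t
  have cE: "c t \<in> E'" and Hc: "H (c t) = l t" if "t \<in> ?J" for t
    using hom lV[OF that] by (auto simp: homeomorphism_def c_def)
  have hc: "h (c t) = 0 \<and> c t $ 2 = s * t" if "t \<in> ?J" for t
    using Hc[OF that] by (simp add: H_def l vec_eq_iff forall_2)
  \<comment> \<open>Differentiating \<open>h (c t) = 0\<close> and \<open>c t $ 2 = s * t\<close>
    determines the velocity of \<open>c\<close>: the second component is \<open>s\<close>, and the
    first is \<open>- s * hv / hu\<close> at \<open>c t\<close>. The inverse \<open>g\<close> is
    only known to be differentiable, so smoothness of \<open>c\<close> is drawn from this
    equation.\<close>
  define X where "X y = (- (s * (hv y * inverse (hu y)))) *\<^sub>R axis 1 1 + (axis 2 s :: real^2)" for y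
  have sX: "smooth_on E1 X"
    unfolding X_def
  proof (intro smooth_on_add smooth_on_scaleR smooth_on_const E1(1))
    have "smooth_on E1 (\<lambda>y. hv y * inverse (hu y))"
      by (intro smooth_on_mult smooth_on_inverse E1(1) hu smooth_on_subset[OF shu E1(3)]
          smooth_on_subset[OF shv E1(3)])
    from smooth_on_mult[OF E1(1) smooth_on_const this, of "- s"]
    show "smooth_on E1 (\<lambda>y. - (s * (hv y * inverse (hu y))))"
      by simp
  qed
  have cX: "(c has_vector_derivative X (c t)) (at t)" if t: "t \<in> ?J" for t
  proof -
    have ld: "(l has_derivative l) (at t)"
      unfolding l_def[abs_def] by (auto intro!: derivative_eq_intros)
    have cd: "(c has_derivative (\<lambda>x. g' (l t) (l x))) (at t)"
      using diff_chain_at[OF ld g[OF lV[OF t]]] by (simp add: o_def c_def[abs_def])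
    define d where "d = g' (l t) (l 1)"
    have lin: "linear (g' (l t))"
      using has_derivative_linear[OF g[OF lV[OF t]]] .
    have "l x = x *\<^sub>R l 1" for x
      by (simp add: l_def)
    then have "g' (l t) (l x) = x *\<^sub>R d" for x
      unfolding d_def using linear_scale[OF lin] by metis
    then have cd': "(c has_derivative (\<lambda>x. x *\<^sub>R d)) (at t)"
      using cd by simp
    have cE1: "c t \<in> E1"
      using cE[OF t] E'(2) by blast
    have "(H \<circ> c has_derivative frechet_derivative H (at (c t)) \<circ> (\<lambda>x. x *\<^sub>R d)) (at t)"
      by (rule diff_chain_at[OF cd' smooth_on_has_derivative[OF sH cE1]])
    moreover have "(H \<circ> c has_derivative l) (at t)"
      by (rule has_derivative_transform_within_open[OF ld _ t]) (simp_all add: Hc)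
    ultimately have "frechet_derivative H (at (c t)) \<circ> (\<lambda>x. x *\<^sub>R d) = l"
      by (rule has_derivative_unique)
    then have "frechet_derivative H (at (c t)) d = l 1"
      by (metis comp_apply scaleR_one)
    then have "d $ 2 = s" "d $ 1 * hu (c t) + d $ 2 * hv (c t) = 0"
      using E1(3) cE1 by (auto simp: DH[OF cE1] l vec_eq_iff forall_2 Dh)
    then have "d = X (c t)"
      using hu[OF cE1] by (simp add: X_def vec_eq_iff forall_2 axis_def field_simps)
    then show ?thesis
      using cd' by (simp add: has_vector_derivative_def)
  qed
  show thesis
  proof (rule that[of E' \<epsilon> c])
    show "smooth_on ?J c"
      using cE E'(2) by (intro smooth_on_integral_curve[OF _ E1(1) sX _ cX]) auto
    show "c 0 = 0"
      using hom E'(3) H0 by (metis c_def homeomorphism_apply1 l_def scaleR_zero_left)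
    show "c (s * y $ 2) = y" if "y \<in> E'" "h y = 0" "\<bar>y $ 2\<bar> < \<epsilon>" for y
    proof -
      have "l (s * y $ 2) = H y"
        using s that(2) by (auto simp: l H_def)
      then show ?thesis
        using hom that(1) by (simp add: c_def homeomorphism_def)
    qed
  qed (use E' E1(3) \<epsilon>(1) cE hc in auto)
qed

section \<open>The standard cuspidal edge\<close>

lemma standard_cuspidal_edge_nth [simp]:
  "standard_cuspidal_edge y $ 1 = y $ 1"
  "standard_cuspidal_edge y $ 2 = y $ 2 * y $ 2"
  "standard_cuspidal_edge y $ 3 = y $ 2 * (y $ 2 * y $ 2)"
  by (simp_all add: standard_cuspidal_edge_def power2_eq_square power3_eq_cube)

lemma smooth_on_standard_cuspidal_edge:
  assumes "open S" "smooth_on S w"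
  shows "smooth_on S (\<lambda>x. standard_cuspidal_edge (w x))"
proof (rule smooth_on_vec[OF assms(1)])
  fix i :: 3
  show "smooth_on S (\<lambda>x. standard_cuspidal_edge (w x) $ i)"
    using exhaust_3[of i] smooth_on_nth[OF assms, of 1] smooth_on_nth[OF assms, of 2]
    by (auto simp: smooth_on_mult[OF assms(1)])
qed

lemma vec3_eqI: "a $ 1 = b $ 1 \<Longrightarrow> a $ 2 = b $ 2 \<Longrightarrow> a $ 3 = b $ 3 \<Longrightarrow> a = (b :: real^3)"
  by (simp add: vec_eq_iff forall_3)

text \<open>At a zero of \<open>v\<close>, a Leibniz term survives only if every factor
  \<open>v\<close> is differentiated at least once. For the square this leaves
  \<open>2 * v'^2\<close> at order two and \<open>6 * v' * v''\<close> at order three; for the cube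
  it leaves \<open>6 * v'^3\<close> at order three.\<close>

lemma
  fixes w :: "'a::euclidean_space \<Rightarrow> real^2"
  assumes "open S" "smooth_on S \<eta>" "smooth_on S w" "x \<in> S" "w x $ 2 = 0"
  shows along_standard_cuspidal_edge: "along \<eta> (\<lambda>x. standard_cuspidal_edge (w x)) x =
      vector [along \<eta> w x $ 1, 0, 0]"
    and along2_standard_cuspidal_edge:
      "along \<eta> (along \<eta> (\<lambda>x. standard_cuspidal_edge (w x))) x =
      vector [along \<eta> (along \<eta> w) x $ 1, 2 * (along \<eta> w x $ 2)\<^sup>2, 0]"
    and along3_standard_cuspidal_edge:
      "along \<eta> (along \<eta> (along \<eta> (\<lambda>x. standard_cuspidal_edge (w x)))) x =
      vector [along \<eta> (along \<eta> (along \<eta> w)) x $ 1,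
        6 * (along \<eta> w x $ 2) * (along \<eta> (along \<eta> w) x $ 2), 6 * (along \<eta> w x $ 2) ^ 3]"
proof -
  define v where "v y = w y $ 2" for y
  let ?Z = "\<lambda>x. standard_cuspidal_edge (w x)"
  have sv: "smooth_on S v" and sZ: "smooth_on S ?Z"
    unfolding v_def by (rule smooth_on_nth smooth_on_standard_cuspidal_edge; fact)+
  have svv: "smooth_on S (\<lambda>y. v y * v y)"
    by (rule smooth_on_mult; fact)
  have v0: "v x = 0"
    using assms by (simp add: v_def)
  note nth = along_power_linear[OF bounded_linear_vec_nth assms(1,2) _ assms(4)]
  have Zn: "(along \<eta> ^^ k) ?Z x $ 1 = (along \<eta> ^^ k) w x $ 1"
    "(along \<eta> ^^ k) ?Z x $ 2 = (along \<eta> ^^ k) (\<lambda>y. v y * v y) x"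
    "(along \<eta> ^^ k) ?Z x $ 3 = (along \<eta> ^^ k) (\<lambda>y. v y * (v y * v y)) x" for k
    using nth[OF sZ, of k 1] nth[OF sZ, of k 2] nth[OF sZ, of k 3] nth[OF assms(3), of k 1]
    by (simp_all add: v_def)
  have wv: "(along \<eta> ^^ k) v x = (along \<eta> ^^ k) w x $ 2" for k
    using nth[OF assms(3), of k 2] by (simp add: v_def[abs_def])
  note vv = along_mult[OF sv sv assms(4), of \<eta>] along2_mult[OF assms(1,2) sv sv assms(4)]
    along3_mult[OF assms(1,2) sv sv assms(4)]
  note vvv = along_mult[OF sv svv assms(4), of \<eta>] along2_mult[OF assms(1,2) sv svv assms(4)]
    along3_mult[OF assms(1,2) sv svv assms(4)]
  show "along \<eta> ?Z x = vector [along \<eta> w x $ 1, 0, 0]"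
    using Zn[of 1] wv[of 1] by (intro vec3_eqI) (simp_all add: vv vvv v0)
  show "along \<eta> (along \<eta> ?Z) x = vector [along \<eta> (along \<eta> w) x $ 1, 2 * (along \<eta> w x $ 2)\<^sup>2, 0]"
    using Zn[of 2] wv[of 1] wv[of 2]
    by (intro vec3_eqI) (simp_all add: vv vvv v0 eval_nat_numeral)
  show "along \<eta> (along \<eta> (along \<eta> ?Z)) x = vector [along \<eta> (along \<eta> (along \<eta> w)) x $ 1,
        6 * (along \<eta> w x $ 2) * (along \<eta> (along \<eta> w) x $ 2), 6 * (along \<eta> w x $ 2) ^ 3]"
    using Zn[of 3] wv[of 1] wv[of 2] wv[of 3]
    by (intro vec3_eqI) (simp_all add: vv vvv v0 eval_nat_numeral algebra_simps)
qed

lemma frechet_derivative_standard_cuspidal_edge: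
  "frechet_derivative standard_cuspidal_edge (at y) d =
    vector [d $ 1, 2 * y $ 2 * d $ 2, 3 * (y $ 2)\<^sup>2 * d $ 2]"
proof -
  have sm: "smooth_on UNIV standard_cuspidal_edge"
    using smooth_on_standard_cuspidal_edge[OF open_UNIV smooth_on_id] .
  have nth: "smooth_on UNIV (\<lambda>x :: real^2. x $ i)" for i
    by (rule smooth_on_nth[OF open_UNIV smooth_on_id])
  have e: "along (\<lambda>_. d) standard_cuspidal_edge y $ i =
      along (\<lambda>_. d) (\<lambda>x. standard_cuspidal_edge x $ i) y" for i
    by (rule along_linear[OF bounded_linear_vec_nth sm UNIV_I, symmetric])
  have n: "along (\<lambda>_. d) (\<lambda>x. x $ i) y = d $ i" for i
    using along_linear[OF bounded_linear_vec_nth smooth_on_id UNIV_I] by (simp add: along_id)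
  have m: "along (\<lambda>_. d) (\<lambda>x. x $ 2 * x $ 2) y = 2 * y $ 2 * d $ 2"
    using along_mult[OF nth nth UNIV_I] by (simp add: n)
  have "along (\<lambda>_. d) (\<lambda>x. x $ 2 * (x $ 2 * x $ 2)) y = 3 * (y $ 2)\<^sup>2 * d $ 2"
    using along_mult[OF nth smooth_on_mult[OF open_UNIV nth nth] UNIV_I]
    by (simp add: n m power2_eq_square)
  then have "along (\<lambda>_. d) standard_cuspidal_edge y =
      vector [d $ 1, 2 * y $ 2 * d $ 2, 3 * (y $ 2)\<^sup>2 * d $ 2]"
    by (intro vec3_eqI) (simp_all add: e n m)
  then show ?thesis
    by (simp add: along_def)
qed

section \<open>Determinants and normal planes\<close>

lemma det_vector_2: "det (vector [a, b] :: real^2^2) = a $ 1 * b $ 2 - a $ 2 * b $ 1"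
  by (simp add: det_2)

text \<open>The vectors stand as rows, so this is multiplicativity of \<open>det\<close> read
  through a transpose. It carries the orientation of a pair of tangent vectors from one coordinate
  system to another.\<close>

lemma det_vector_linear:
  fixes L :: "real^2 \<Rightarrow> real^2"
  assumes "linear L"
  shows "det (vector [L a, L b] :: real^2^2) = det (matrix L) * det (vector [a, b] :: real^2^2)"
proof -
  have "det (vector [A *v a, A *v b] :: real^2^2) = det A * det (vector [a, b] :: real^2^2)"
    for A :: "real^2^2"
    by (simp add: det_2 matrix_vector_mult_def sum_2 algebra_simps)
  from this[of "matrix L"] show ?thesis
    using assms by (simp add: matrix_works)
qed

lemma linear_vector_3:
  fixes L :: "real^3 \<Rightarrow> real^3"
  assumes "linear L"
  shows "L (vector [x, y, z]) = x *\<^sub>R L (axis 1 1) + y *\<^sub>R L (axis 2 1) + z *\<^sub>R L (axis 3 1)"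
proof -
  have "(vector [x, y, z] :: real^3) = x *\<^sub>R axis 1 1 + y *\<^sub>R axis 2 1 + z *\<^sub>R axis 3 1"
    by (rule vec3_eqI) (simp_all add: axis_def)
  then show ?thesis
    using assms by (simp add: linear_add linear_scale)
qed

text \<open>Over the frame \<open>L (axis i 1)\<close> the coefficients are triangular with diagonal
  \<open>a\<close>, \<open>2 * b\<^sup>2\<close>, \<open>6 * b ^ 3\<close>. This is the source of
  \<open>12 * a * b ^ 5\<close> and the reason why \<open>u\<close>, \<open>u'\<close> and
  \<open>v'\<close> disappear.\<close>

lemma
  fixes L :: "real^3 \<Rightarrow> real^3"
  assumes "linear L"
  shows det_image_cusp_frame:
    "det (vector [L (vector [a, 0, 0]), L (vector [u, 2 * b\<^sup>2, 0]), L (vector [u', v', 6 * b ^ 3])]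
      :: real^3^3) = 12 * a * b ^ 5 * det (vector [L (axis 1 1), L (axis 2 1), L (axis 3 1)] :: real^3^3)"
    and cross3_image_cusp_frame:
    "cross3 (L (vector [a, 0, 0])) (L (vector [u, 2 * b\<^sup>2, 0])) =
      (2 * a * b\<^sup>2) *\<^sub>R cross3 (L (axis 1 1)) (L (axis 2 1))"
   by (simp_all add: linear_vector_3[OF assms] det_3 cross3_def vec_eq_iff forall_3 algebra_simps
      power2_eq_square power3_eq_cube eval_nat_numeral)

lemma det_image_basis_nonzero:
  fixes L :: "real^3 \<Rightarrow> real^3"
  assumes "linear L" "inj L"
  shows "det (vector [L (axis 1 1), L (axis 2 1), L (axis 3 1)] :: real^3^3) \<noteq> 0"
proof -
  have "(vector [L (axis 1 1), L (axis 2 1), L (axis 3 1)] :: real^3^3) = transpose (matrix L)"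
    by (rule vec_eq_iff[THEN iffD2]) (simp add: forall_3 vec_eq_iff transpose_def matrix_def)
  then show ?thesis
    using det_nz_iff_inj[OF assms(1)] assms(2) by (simp add: det_transpose)
qed

section \<open>Lengths and areas in the oriented normal plane\<close>

context
  fixes n e1 e2 :: "real^3"
  assumes basis: "positive_orthonormal_basis n e1 e2"
begin

text \<open>Gram's identity: the squared determinant is the determinant of the inner products, here
  \<open>(norm n)\<^sup>2\<close>. Positivity of the basis selects the root.\<close>

lemma det_positive_orthonormal_basis: "det (vector [n, e1, e2] :: real^3^3) = norm n"
proof -
  have d: "e1 \<bullet> e1 = 1" "e2 \<bullet> e2 = 1" "e1 \<bullet> e2 = 0" "e1 \<bullet> n = 0" "e2 \<bullet> n = 0"
    using basis by (auto simp: positive_orthonormal_basis_def norm_eq_1)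
  have "(det (vector [n, e1, e2] :: real^3^3))\<^sup>2 =
      (n \<bullet> n) * (e1 \<bullet> e1) * (e2 \<bullet> e2) + 2 * (e1 \<bullet> n) * (e1 \<bullet> e2) * (e2 \<bullet> n)
      - (n \<bullet> n) * (e1 \<bullet> e2)\<^sup>2 - (e1 \<bullet> e1) * (e2 \<bullet> n)\<^sup>2 - (e2 \<bullet> e2) * (e1 \<bullet> n)\<^sup>2"
    by (simp add: det_3 inner_vec_def sum_3 power2_eq_square algebra_simps)
  then have "(det (vector [n, e1, e2] :: real^3^3))\<^sup>2 = (norm n)\<^sup>2"
    by (simp add: d power2_norm_eq_inner)
  then show ?thesis
    using basis by (simp add: positive_orthonormal_basis_def power2_eq_iff_nonneg)
qed

text \<open>What remains of \<open>a\<close> after subtracting its two projections is orthogonal to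
  \<open>n\<close>, \<open>e1\<close> and \<open>e2\<close>, the rows of an invertible matrix, and
  is therefore zero.\<close>

lemma normal_plane_expansion:
  assumes a: "a \<bullet> n = 0"
  shows "a = (a \<bullet> e1) *\<^sub>R e1 + (a \<bullet> e2) *\<^sub>R e2"
proof -
  let ?r = "a - (a \<bullet> e1) *\<^sub>R e1 - (a \<bullet> e2) *\<^sub>R e2"
  let ?M = "vector [n, e1, e2] :: real^3^3"
  have d: "e1 \<bullet> e1 = 1" "e2 \<bullet> e2 = 1" "e1 \<bullet> e2 = 0" "e1 \<bullet> n = 0" "e2 \<bullet> n = 0"
    using basis by (auto simp: positive_orthonormal_basis_def norm_eq_1)
  have d': "e2 \<bullet> e1 = 0" "n \<bullet> e1 = 0" "n \<bullet> e2 = 0" "n \<bullet> a = 0"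
    using d a by (simp_all add: inner_commute)
  have "?M *v ?r = 0"
    using inner_commute[of e1 a] inner_commute[of e2 a]
    by (intro vec3_eqI) (simp_all add: matrix_vector_mul_component d d' inner_diff_right)
  moreover have "invertible ?M"
    using basis by (simp add: positive_orthonormal_basis_def invertible_det_nz)
  ultimately have "?r = 0"
    by (metis matrix_left_invertible_ker invertible_def)
  then show ?thesis
    by (simp add: algebra_simps)
qed

lemma norm_cross3_normal_plane:
  assumes a: "a \<bullet> n = 0"
  shows "norm (cross3 n a) = norm n * norm (vector [a \<bullet> e1, a \<bullet> e2] :: real^2)"
proof -
  have d: "e1 \<bullet> e1 = 1" "e2 \<bullet> e2 = 1" "e1 \<bullet> e2 = 0"
    using basis by (auto simp: positive_orthonormal_basis_def norm_eq_1)
  have "a \<bullet> a = a \<bullet> ((a \<bullet> e1) *\<^sub>R e1 + (a \<bullet> e2) *\<^sub>R e2)"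
    using normal_plane_expansion[OF a] by (rule arg_cong)
  then have "a \<bullet> a = (a \<bullet> e1)\<^sup>2 + (a \<bullet> e2)\<^sup>2"
    by (simp add: inner_add_right power2_eq_square)
  then have "norm a = norm (vector [a \<bullet> e1, a \<bullet> e2] :: real^2)"
    unfolding norm_eq_sqrt_inner by (simp add: inner_vec_def sum_2 power2_eq_square)
  moreover have "(norm (cross3 n a))\<^sup>2 = (norm n * norm a)\<^sup>2"
    using norm_cross_dot[of n a] a by (simp add: inner_commute)
  ultimately show ?thesis
    by (simp add: power2_eq_iff_nonneg)
qed

lemma det_normal_plane:
  assumes a: "a \<bullet> n = 0" and b: "b \<bullet> n = 0"
  shows "det (vector [n, a, b] :: real^3^3) =
    norm n * det (vector [vector [a \<bullet> e1, a \<bullet> e2], vector [b \<bullet> e1, b \<bullet> e2]] :: real^2^2)"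
proof -
  have d: "det (vector [n, e1, e2] :: real^3^3) = norm n"
    by (rule det_positive_orthonormal_basis)
  have "det (vector [n, x *\<^sub>R e1 + y *\<^sub>R e2, z *\<^sub>R e1 + w *\<^sub>R e2] :: real^3^3) =
      (x * w - y * z) * det (vector [n, e1, e2] :: real^3^3)" for x y z w
    by (simp add: det_3 algebra_simps)
  moreover have "b = (b \<bullet> e1) *\<^sub>R e1 + (b \<bullet> e2) *\<^sub>R e2"
    by (rule normal_plane_expansion[OF b])
  ultimately show ?thesis
    using normal_plane_expansion[OF a] d by (metis (no_types, lifting) det_vector_2 mult.commute vector_2)
qed

end

text \<open>In plane coordinates the determinant and the cross product each release one factor
  \<open>norm n\<close>, so \<open>norm n powr (3/2)\<close> completes the numerator to
  \<open>norm n powr (5/2)\<close>, which the denominator cancels. The scaling cancels because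
  \<open>(r\<^sup>2) powr (5/2)\<close> is \<open>r ^ 5\<close> for positive
  \<open>r\<close>.\<close>

lemma cuspidal_curvature_section:
  fixes n F2 F3 s2 s3 e1 e2 :: "real^3"
  assumes "positive_orthonormal_basis n e1 e2" "s2 \<bullet> n = 0" "s3 \<bullet> n = 0" "n \<noteq> 0" "r > 0"
    and det: "det (vector [n, s2, s3] :: real^3^3) = r ^ 5 * det (vector [n, F2, F3] :: real^3^3)"
    and cross: "norm (cross3 n s2) = r\<^sup>2 * norm (cross3 n F2)"
  shows "norm n powr (3/2) * det (vector [n, F2, F3] :: real^3^3) / norm (cross3 n F2) powr (5/2) =
    det (vector [vector [s2 \<bullet> e1, s2 \<bullet> e2], vector [s3 \<bullet> e1, s3 \<bullet> e2]] :: real^2^2)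
      / norm (vector [s2 \<bullet> e1, s2 \<bullet> e2] :: real^2) powr (5/2)"
proof -
  define N where "N = norm n"
  define m where "m = norm (vector [s2 \<bullet> e1, s2 \<bullet> e2] :: real^2)"
  define d where "d = det (vector [vector [s2 \<bullet> e1, s2 \<bullet> e2], vector [s3 \<bullet> e1, s3 \<bullet> e2]] :: real^2^2)"
  have pos: "N > 0" "m \<ge> 0"
    using assms(4) by (simp_all add: N_def m_def)
  have F: "det (vector [n, F2, F3] :: real^3^3) = N * d / r ^ 5"
    using det_normal_plane[OF assms(1-3)] det assms(5) by (simp add: N_def d_def field_simps)
  have C: "norm (cross3 n F2) = N * m / r\<^sup>2"
    using norm_cross3_normal_plane[OF assms(1,2)] cross assms(5) by (simp add: N_def m_def field_simps)
  have "(r\<^sup>2) powr (5/2) = r ^ 5"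
    using assms(5) by (simp add: powr_powr flip: powr_numeral powr_realpow)
  then have P: "(N * m / r\<^sup>2) powr (5/2) = N powr (5/2) * m powr (5/2) / r ^ 5"
    using pos assms(5) by (simp add: powr_divide powr_mult)
  have "N powr (3/2) * N = N powr (5/2)"
    using pos powr_add[of N "3/2" 1] by simp
  moreover have "(x * (N * d / r ^ 5)) / (x * N * y / r ^ 5) = d / y" if "x > 0" for x y
    using pos assms(5) that by (simp add: field_simps)
  from this[of "N powr (3/2)"] have "N powr (3/2) * (N * d / r ^ 5) / (N powr (3/2) * N * m powr (5/2) / r ^ 5) = d / m powr (5/2)"
    using pos by simp
  ultimately show ?thesis
    unfolding F C P by (simp add: N_def m_def d_def)
qed

section \<open>A cuspidal edge in adapted coordinates\<close>

locale cuspidal_edge_coordinates =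
  fixes M :: "'a::{t2_space,second_countable_topology} set" and \<A> :: "'a chart2 set"
    and f :: "'a \<Rightarrow> real^3" and p :: 'a
    and W :: "'a set" and \<Phi> :: "'a \<Rightarrow> real^2"
    and C D :: "(real^3) set" and \<Psi> :: "real^3 \<Rightarrow> real^3"
    and I :: "real set" and \<gamma> :: "real \<Rightarrow> 'a" and n :: "real^3"
  assumes surface: "oriented_surface M \<A>"
    and coords: "local_coordinates M \<A> W \<Phi>" and p: "p \<in> W" "\<Phi> p = 0"
    and diffeo: "diffeo_between C D \<Psi>" and f_in: "f ` W \<subseteq> C"
    and \<Psi>_f: "\<And>q. q \<in> W \<Longrightarrow> \<Psi> (f q) = standard_cuspidal_edge (\<Phi> q)"
    and singular: "singular_curve M \<A> f p I \<gamma>"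
    and n: "n = vector_derivative (f \<circ> \<gamma>) (at 0)"
begin

text \<open>The inverse of the target diffeomorphism: on \<open>W\<close> the map \<open>f\<close>
  is the normal form in the coordinates \<open>\<Phi>\<close> followed by \<open>G\<close>.\<close>

definition "G = inv_into C \<Psi>"

lemma open_D: "open D" and smooth_G: "smooth_on D G"
  using diffeo by (auto simp: diffeo_between_def G_def)

lemma standard_in_D: "q \<in> W \<Longrightarrow> standard_cuspidal_edge (\<Phi> q) \<in> D"
  and f_eq_G: "q \<in> W \<Longrightarrow> f q = G (standard_cuspidal_edge (\<Phi> q))"
proof -
  assume q: "q \<in> W"
  then have "f q \<in> C" using f_in by blast
  then show "standard_cuspidal_edge (\<Phi> q) \<in> D" "f q = G (standard_cuspidal_edge (\<Phi> q))"
    using diffeo imageI[of "f q" C \<Psi>] unfolding \<Psi>_f[OF q, symmetric]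
    by (auto simp: diffeo_between_def bij_betw_def G_def)
qed

text \<open>\<open>\<Psi>\<close> undoes \<open>G\<close> on \<open>D\<close>, so by the chain rule
  the differential of \<open>\<Psi>\<close> is a left inverse of that of \<open>G\<close>.\<close>

lemma
  assumes "z \<in> D"
  shows linear_DG: "linear (frechet_derivative G (at z))"
    and inj_DG: "inj (frechet_derivative G (at z))"
proof -
  have bij: "bij_betw \<Psi> C D" and sm: "smooth_on C \<Psi>"
    using diffeo by (auto simp: diffeo_between_def)
  have GC: "G z \<in> C"
    using bij assms inv_into_into[of z \<Psi> C] by (simp add: G_def bij_betw_def)
  have "\<Psi> (G y) = y" if "y \<in> D" for y
    using bij that f_inv_into_f[of y \<Psi> C] by (simp add: G_def bij_betw_def)
  from frechet_derivative_left_inverse[OF open_D assms smooth_on_imp_differentiable[OF smooth_G assms]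
      smooth_on_imp_differentiable[OF sm GC] this]
  show "inj (frechet_derivative G (at z))"
    by (rule inj_on_inverseI)
  show "linear (frechet_derivative G (at z))"
    by (rule linear_frechet_derivative[OF smooth_on_imp_differentiable[OF smooth_G assms]])
qed

lemma standard_0: "standard_cuspidal_edge 0 = 0"
  by (rule vec3_eqI) simp_all

lemma D_0: "0 \<in> D"
  using standard_in_D[OF p(1)] by (simp add: p standard_0)

lemma open_W: "open W" and inj_\<Phi>: "inj_on \<Phi> W"
  using coords by (auto simp: local_coordinates_def)

section \<open>Passage between a chart of the atlas and the adapted coordinates\<close>

context
  fixes U :: "'a set" and \<phi> :: "'a \<Rightarrow> real^2"
  assumes chart: "(U, \<phi>) \<in> \<A>"
begin

abbreviation "T \<equiv> \<Phi> \<circ> inv_into U \<phi>"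
abbreviation "T' \<equiv> \<phi> \<circ> inv_into W \<Phi>"

lemma open_U: "open U" and homeo_chart: "homeomorphism U (\<phi> ` U) \<phi> (inv_into U \<phi>)"
  and open_chart_image: "open (\<phi> ` U)"
  using surface chart unfolding oriented_surface_def by auto

lemma smooth_T: "smooth_on (\<phi> ` (U \<inter> W)) T"
  and smooth_T': "smooth_on (\<Phi> ` (U \<inter> W)) T'"
  using coords chart by (auto simp: local_coordinates_def smooth_map_on_def)

lemma T_apply: "q \<in> U \<Longrightarrow> T (\<phi> q) = \<Phi> q"
  using homeo_chart by (simp add: homeomorphism_def)

lemma T'_apply: "q \<in> W \<Longrightarrow> T' (\<Phi> q) = \<phi> q"
  using inj_\<Phi> by simp

lemma open_chart_image_Int:
  assumes "open X"
  shows "open (\<phi> ` (U \<inter> X))"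
proof -
  have "openin (top_of_set (\<phi> ` U)) (\<phi> ` (U \<inter> X))"
    by (rule homeomorphism_imp_open_map[OF homeo_chart]) (simp add: openin_open_Int assms)
  then show ?thesis
    using open_chart_image openin_open_trans by blast
qed

lemmas open_\<phi>_image = open_chart_image_Int[OF open_W]

text \<open>\<open>local_coordinates\<close> asks for an open image of the whole of
  \<open>W\<close>. For the part inside \<open>U\<close>, invariance of domain is applied to
  \<open>T\<close>, which is continuous and injective on an open set.\<close>

lemma open_\<Phi>_image: "open (\<Phi> ` (U \<inter> W))"
proof -
  have eq: "T ` \<phi> ` (U \<inter> W) = \<Phi> ` (U \<inter> W)"
    using T_apply by (force simp: image_image)
  have "open (T ` \<phi> ` (U \<inter> W))"
  proof (rule invariance_of_domain[OF smooth_on_imp_continuous_on[OF smooth_T] open_\<phi>_image])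
    show "inj_on T (\<phi> ` (U \<inter> W))"
    proof (rule inj_onI)
      fix x y assume "x \<in> \<phi> ` (U \<inter> W)" "y \<in> \<phi> ` (U \<inter> W)" "T x = T y"
      then obtain q q' where q: "x = \<phi> q" "y = \<phi> q'" "q \<in> U" "q' \<in> U" "q \<in> W" "q' \<in> W"
        by blast
      then have "\<Phi> q = \<Phi> q'"
        using \<open>T x = T y\<close> by (simp only: q T_apply)
      then show "x = y"
        using inj_\<Phi> q by (metis inj_onD)
    qed
  qed
  then show ?thesis
    by (simp only: eq)
qed

lemma DT_inverse:
  assumes "q \<in> U" "q \<in> W"
  shows "frechet_derivative T' (at (\<Phi> q)) (frechet_derivative T (at (\<phi> q)) v) = v"
    and "frechet_derivative T (at (\<phi> q)) (frechet_derivative T' (at (\<Phi> q)) v) = v"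
proof -
  have m: "\<phi> q \<in> \<phi> ` (U \<inter> W)" "\<Phi> q \<in> \<Phi> ` (U \<inter> W)"
    using assms by auto
  note d = smooth_on_imp_differentiable[OF smooth_T m(1)] smooth_on_imp_differentiable[OF smooth_T' m(2)]
  have e: "T (\<phi> q) = \<Phi> q" "T' (\<Phi> q) = \<phi> q"
    using T_apply T'_apply assms by auto
  have "T' (T y) = y" if "y \<in> \<phi> ` (U \<inter> W)" for y
    using that by (auto simp: T_apply T'_apply simp del: o_apply)
  from frechet_derivative_left_inverse[OF open_\<phi>_image m(1) d(1) _ this]
  show "frechet_derivative T' (at (\<Phi> q)) (frechet_derivative T (at (\<phi> q)) v) = v"
    using d(2) by (simp only: e)
  have "T (T' y) = y" if "y \<in> \<Phi> ` (U \<inter> W)" for y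
    using that by (auto simp: T_apply T'_apply simp del: o_apply)
  from frechet_derivative_left_inverse[OF open_\<Phi>_image m(2) d(2) _ this]
  show "frechet_derivative T (at (\<phi> q)) (frechet_derivative T' (at (\<Phi> q)) v) = v"
    using d(1) by (simp only: e)
qed

lemma linear_DT: "q \<in> U \<Longrightarrow> q \<in> W \<Longrightarrow> linear (frechet_derivative T (at (\<phi> q)))"
  and linear_DT': "q \<in> U \<Longrightarrow> q \<in> W \<Longrightarrow> linear (frechet_derivative T' (at (\<Phi> q)))"
  using linear_frechet_derivative smooth_on_imp_differentiable smooth_T smooth_T' by blast+

lemma smooth_standard_T: "smooth_on (\<phi> ` (U \<inter> W)) (\<lambda>x. standard_cuspidal_edge (T x))"
  by (rule smooth_on_standard_cuspidal_edge[OF open_\<phi>_image smooth_T])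

lemma standard_T_in: "(\<lambda>x. standard_cuspidal_edge (T x)) ` \<phi> ` (U \<inter> W) \<subseteq> D"
  using standard_in_D by (auto simp: T_apply simp del: o_apply)

lemma f_chart_eq: "x \<in> \<phi> ` (U \<inter> W) \<Longrightarrow> G (standard_cuspidal_edge (T x)) = (f \<circ> inv_into U \<phi>) x"
  using f_eq_G homeo_chart by (auto simp: homeomorphism_def)

lemma smooth_f_chart: "smooth_on (\<phi> ` (U \<inter> W)) (\<lambda>x. G (standard_cuspidal_edge (T x)))"
  by (rule smooth_on_compose[OF open_\<phi>_image open_D standard_T_in smooth_standard_T smooth_G])

lemma along_f_chart:
  assumes "q \<in> U" "q \<in> W"
  shows "along \<eta> (f \<circ> inv_into U \<phi>) (\<phi> q) =
    frechet_derivative G (at (standard_cuspidal_edge (\<Phi> q)))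
      (along \<eta> (\<lambda>x. standard_cuspidal_edge (T x)) (\<phi> q))"
proof -
  have m: "\<phi> q \<in> \<phi> ` (U \<inter> W)"
    using assms by auto
  have "along \<eta> (f \<circ> inv_into U \<phi>) (\<phi> q) = along \<eta> (\<lambda>x. G (standard_cuspidal_edge (T x))) (\<phi> q)"
    by (rule along_cong[OF open_\<phi>_image m smooth_f_chart f_chart_eq])
  also have "\<dots> = frechet_derivative G (at (standard_cuspidal_edge (T (\<phi> q))))
      (along \<eta> (\<lambda>x. standard_cuspidal_edge (T x)) (\<phi> q))"
    using standard_T_in m
    by (intro along_compose[OF smooth_standard_T smooth_G m]) (auto simp del: o_apply)
  finally show ?thesis
    using assms(1) by (simp only: T_apply)
qed

text \<open>Off the axis \<open>v = 0\<close> the first two components of the normal form already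
  have an invertible differential, diagonal with entries \<open>1\<close> and \<open>2 * v\<close>.
  The differentials of \<open>T\<close> and \<open>G\<close> are injective, so \<open>f\<close> is
  immersive there. This confines the singular curve to the axis.\<close>

lemma singular_imp_chart:
  assumes "q \<in> U" "q \<in> W" "\<not> inj (differential (U, \<phi>) f q)"
  shows "\<Phi> q $ 2 = 0"
proof (rule ccontr)
  assume v: "\<Phi> q $ 2 \<noteq> 0"
  have m: "\<phi> q \<in> \<phi> ` (U \<inter> W)"
    using assms by auto
  have sm: "smooth_on UNIV standard_cuspidal_edge"
    using smooth_on_standard_cuspidal_edge[OF open_UNIV smooth_on_id] .
  let ?L = "frechet_derivative G (at (standard_cuspidal_edge (\<Phi> q)))"
  have D: "differential (U, \<phi>) f q a = ?L (frechet_derivative standard_cuspidal_edge (at (\<Phi> q))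
      (frechet_derivative T (at (\<phi> q)) a))" for a
  proof -
    have "along (\<lambda>_. a) (\<lambda>x. standard_cuspidal_edge (T x)) (\<phi> q) =
        frechet_derivative standard_cuspidal_edge (at (T (\<phi> q))) (along (\<lambda>_. a) T (\<phi> q))"
      by (rule along_compose[OF smooth_T sm m UNIV_I])
    then show ?thesis
      using along_f_chart[OF assms(1,2), of "\<lambda>_. a"]
      by (simp only: T_apply[OF assms(1)]) (simp add: along_def differential_def)
  qed
  have "inj (differential (U, \<phi>) f q)"
  proof (rule injI)
    fix a b assume "differential (U, \<phi>) f q a = differential (U, \<phi>) f q b"
    then have *: "frechet_derivative standard_cuspidal_edge (at (\<Phi> q)) (frechet_derivative T (at (\<phi> q)) a) =
        frechet_derivative standard_cuspidal_edge (at (\<Phi> q)) (frechet_derivative T (at (\<phi> q)) b)"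
      using inj_DG[OF standard_in_D[OF assms(2)]] unfolding D by (simp add: inj_eq)
    have "d $ 1 = e $ 1 \<and> d $ 2 = e $ 2"
      if "frechet_derivative standard_cuspidal_edge (at (\<Phi> q)) d =
        frechet_derivative standard_cuspidal_edge (at (\<Phi> q)) e" for d e
      using arg_cong[OF that, of "\<lambda>z. z $ 1"] arg_cong[OF that, of "\<lambda>z. z $ 2"] v
      by (simp add: frechet_derivative_standard_cuspidal_edge)
    from this[OF *] have "frechet_derivative T (at (\<phi> q)) a = frechet_derivative T (at (\<phi> q)) b"
      by (simp add: vec_eq_iff forall_2)
    then show "a = b"
      by (metis DT_inverse(1)[OF assms(1,2)])
  qed
  then show False
    using assms(3) by blast
qed

text \<open>Regularity of a curve is stated in charts. Composition with \<open>T\<close> transfers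
  it to adapted coordinates, and from there to the image curve through \<open>G\<close>; times in
  \<open>S\<close> keep the curve in the domains of both \<open>\<phi>\<close> and
  \<open>\<Phi>\<close>.\<close>

lemma
  assumes "regular_curve M \<A> J c"
  defines "S \<equiv> J \<inter> c -` (U \<inter> W)"
  shows open_curve_preimage: "open S"
    and smooth_on_coordinate_curve: "smooth_on S (\<lambda>t. \<Phi> (c t))"
    and smooth_on_standard_curve: "smooth_on S (\<lambda>t. standard_cuspidal_edge (\<Phi> (c t)))"
    and smooth_on_image_curve: "smooth_on S (\<lambda>t. f (c t))"
    and chart_curve_velocity: "t \<in> S \<Longrightarrow>
      vector_derivative (\<phi> \<circ> c) (at t) = along (\<lambda>_. 1) (\<lambda>t. \<phi> (c t)) t"
    and chart_curve_velocity_nonzero: "t \<in> S \<Longrightarrow> along (\<lambda>_. 1) (\<lambda>t. \<phi> (c t)) t \<noteq> 0"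
    and coordinate_curve_velocity: "t \<in> S \<Longrightarrow> along (\<lambda>_. 1) (\<lambda>t. \<Phi> (c t)) t =
      frechet_derivative T (at (\<phi> (c t))) (along (\<lambda>_. 1) (\<lambda>t. \<phi> (c t)) t)"
proof -
  have J: "open J" "continuous_on J c"
    and c: "smooth_on (J \<inter> c -` U) (\<phi> \<circ> c)"
      "\<And>t. t \<in> J \<inter> c -` U \<Longrightarrow> vector_derivative (\<phi> \<circ> c) (at t) \<noteq> 0"
    using assms(1) chart unfolding regular_curve_def by auto
  show op: "open S"
    using continuous_on_open_vimage[OF J(1), of c] J(2) open_Int[OF open_U open_W]
    by (auto simp: S_def Int_commute)
  have s1: "smooth_on S (\<lambda>t. \<phi> (c t))"
    using smooth_on_subset[OF c(1), of S] by (auto simp: S_def o_def)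
  have sub: "(\<lambda>t. \<phi> (c t)) ` S \<subseteq> \<phi> ` (U \<inter> W)"
    by (auto simp: S_def)
  have e: "T (\<phi> (c t)) = \<Phi> (c t)" if "t \<in> S" for t
    using that by (intro T_apply) (auto simp: S_def)
  have sT: "smooth_on S (\<lambda>t. T (\<phi> (c t)))"
    by (rule smooth_on_compose[OF op open_\<phi>_image sub s1 smooth_T])
  show s2: "smooth_on S (\<lambda>t. \<Phi> (c t))"
    by (rule smooth_on_cong[OF op e sT])
  show s3: "smooth_on S (\<lambda>t. standard_cuspidal_edge (\<Phi> (c t)))"
    by (rule smooth_on_standard_cuspidal_edge[OF op s2])
  have sub': "(\<lambda>t. standard_cuspidal_edge (\<Phi> (c t))) ` S \<subseteq> D"
    using standard_in_D by (auto simp: S_def)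
  show "smooth_on S (\<lambda>t. f (c t))"
    by (rule smooth_on_cong[OF op _ smooth_on_compose[OF op open_D sub' s3 smooth_G]])
      (auto simp: S_def f_eq_G)
  assume t: "t \<in> S"
  show v: "vector_derivative (\<phi> \<circ> c) (at t) = along (\<lambda>_. 1) (\<lambda>t. \<phi> (c t)) t"
    using curve_derivative_eq_along[OF smooth_on_imp_differentiable[OF s1 t]] by (simp add: o_def)
  show "along (\<lambda>_. 1) (\<lambda>t. \<phi> (c t)) t \<noteq> 0"
    using c(2)[of t] t unfolding v by (auto simp: S_def)
  have "along (\<lambda>_. 1) (\<lambda>t. \<Phi> (c t)) t = along (\<lambda>_. 1) (\<lambda>t. T (\<phi> (c t))) t"
    by (rule along_cong[OF op t sT e])
  also have "\<dots> = frechet_derivative T (at (\<phi> (c t))) (along (\<lambda>_. 1) (\<lambda>t. \<phi> (c t)) t)"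
    using t sub by (intro along_compose[OF s1 smooth_T t]) auto
  finally show "along (\<lambda>_. 1) (\<lambda>t. \<Phi> (c t)) t =
      frechet_derivative T (at (\<phi> (c t))) (along (\<lambda>_. 1) (\<lambda>t. \<phi> (c t)) t)" .
qed

end

section \<open>The tangent of the edge and the derivatives at the origin\<close>

abbreviation "L \<equiv> frechet_derivative G (at 0)"

lemma chart_at_p: obtains U \<phi> where "(U, \<phi>) \<in> \<A>" "p \<in> U"
proof -
  have "p \<in> M"
    using coords p(1) by (auto simp: local_coordinates_def)
  then show thesis
    using that surface unfolding oriented_surface_def by blast
qed

lemma regular_\<gamma>: "regular_curve M \<A> I \<gamma>" and \<gamma>_0: "0 \<in> I" "\<gamma> 0 = p"
  using singular by (auto simp: singular_curve_def)

lemma DT_nonzero: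
  assumes "(U, \<phi>) \<in> \<A>" "q \<in> U" "q \<in> W" "v \<noteq> 0"
  shows "frechet_derivative (T U \<phi>) (at (\<phi> q)) v \<noteq> 0"
  using DT_inverse(1)[OF assms(1-3), of v] linear_DT'[OF assms(1-3)] assms(4)
  by (metis linear_0)

text \<open>The sign of \<open>a\<close> is open, since \<open>\<Phi>\<close> need not respect the
  direction of \<open>\<gamma>\<close>.\<close>

definition "a = along (\<lambda>_. 1) (\<lambda>t. \<Phi> (\<gamma> t)) 0 $ 1"

text \<open>Near \<open>0\<close> the curve consists of singular points, so its
  \<open>v\<close>-coordinate is identically zero there and so is the derivative of that coordinate.
  Regularity then forces a non-zero \<open>u\<close>-component.\<close>

lemma singular_curve_velocity: "along (\<lambda>_. 1) (\<lambda>t. \<Phi> (\<gamma> t)) 0 = vector [a, 0]"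
  and a_nonzero: "a \<noteq> 0"
  and n_eq: "n = L (vector [a, 0, 0])"
proof -
  obtain U \<phi> where ch: "(U, \<phi>) \<in> \<A>" "p \<in> U"
    by (rule chart_at_p)
  define S where "S = I \<inter> \<gamma> -` (U \<inter> W)"
  note curve = regular_\<gamma>[THEN open_curve_preimage[OF ch(1)], folded S_def]
    regular_\<gamma>[THEN smooth_on_coordinate_curve[OF ch(1)], folded S_def]
    regular_\<gamma>[THEN smooth_on_standard_curve[OF ch(1)], folded S_def]
    regular_\<gamma>[THEN smooth_on_image_curve[OF ch(1)], folded S_def]
  have S0: "0 \<in> S"
    using \<gamma>_0 p ch by (simp add: S_def)
  obtain V where V: "open V" "p \<in> V" "V \<inter> singular_set M \<A> f = V \<inter> \<gamma> ` I"
    using singular by (auto simp: singular_curve_def)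
  \<comment> \<open>Points of \<open>\<gamma>\<close> are known to be singular only inside
    \<open>V\<close>.\<close>
  define S' where "S' = S \<inter> \<gamma> -` V"
  have I: "open I" "continuous_on I \<gamma>"
    using regular_\<gamma> by (auto simp: regular_curve_def)
  have "open (I \<inter> \<gamma> -` V)"
    using continuous_on_open_vimage[OF I(1), of \<gamma>] I(2) V(1) by (auto simp: Int_commute)
  then have "open (S \<inter> (I \<inter> \<gamma> -` V))"
    using curve(1) by blast
  moreover have "S \<inter> (I \<inter> \<gamma> -` V) = S'"
    by (auto simp: S'_def S_def)
  ultimately have oS': "open S'"
    by simp
  have S'0: "0 \<in> S'"
    using S0 \<gamma>_0 V by (simp add: S'_def)
  have sub: "S' \<subseteq> S"
    by (simp add: S'_def)
  have z: "0 = \<Phi> (\<gamma> t) $ 2" if "t \<in> S'" for t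
  proof -
    have t: "t \<in> I" "\<gamma> t \<in> W" "\<gamma> t \<in> V"
      using that by (auto simp: S'_def S_def)
    then have "\<not> immersive_at \<A> f (\<gamma> t)"
      using V(3) by (auto simp: singular_set_def)
    then obtain U' \<phi>' where "(U', \<phi>') \<in> \<A>" "\<gamma> t \<in> U'" "\<not> inj (differential (U', \<phi>') f (\<gamma> t))"
      unfolding immersive_at_def by blast
    from singular_imp_chart[OF this(1,2) t(2) this(3)] show ?thesis
      by simp
  qed
  have "along (\<lambda>_. 1) (\<lambda>t. \<Phi> (\<gamma> t) $ 2) 0 = along (\<lambda>_. 1) (\<lambda>t. 0::real) (0::real)"
    by (rule along_cong[OF oS' S'0 smooth_on_const z])
  then have "along (\<lambda>_. 1) (\<lambda>t. \<Phi> (\<gamma> t)) 0 $ 2 = 0"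
    using along_linear[OF bounded_linear_vec_nth[of 2] curve(2) S0, of "\<lambda>_. 1"] by simp
  then show v: "along (\<lambda>_. 1) (\<lambda>t. \<Phi> (\<gamma> t)) 0 = vector [a, 0]"
    by (simp add: vec_eq_iff forall_2 a_def)
  have "along (\<lambda>_. 1) (\<lambda>t. \<Phi> (\<gamma> t)) 0 \<noteq> 0"
    using regular_\<gamma>[THEN coordinate_curve_velocity[OF ch(1)], folded S_def, OF S0]
      regular_\<gamma>[THEN chart_curve_velocity_nonzero[OF ch(1)], folded S_def, OF S0]
      DT_nonzero[OF ch p(1)] by (simp add: \<gamma>_0)
  then show "a \<noteq> 0"
    unfolding v by (auto simp: vec_eq_iff forall_2)
  have "n = along (\<lambda>_. 1) (\<lambda>t. f (\<gamma> t)) 0"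
    using curve_derivative_eq_along[OF smooth_on_imp_differentiable[OF curve(4) S0]]
    by (simp add: n o_def)
  also have "\<dots> = along (\<lambda>_. 1) (\<lambda>t. G (standard_cuspidal_edge (\<Phi> (\<gamma> t)))) 0"
  proof (rule along_cong[OF curve(1) S0])
    show "smooth_on S (\<lambda>t. G (standard_cuspidal_edge (\<Phi> (\<gamma> t))))"
      using standard_in_D
      by (intro smooth_on_compose[OF curve(1) open_D _ curve(3) smooth_G]) (auto simp: S_def)
  qed (use f_eq_G in \<open>auto simp: S_def\<close>)
  also have "\<dots> = L (along (\<lambda>_. 1) (\<lambda>t. standard_cuspidal_edge (\<Phi> (\<gamma> t))) 0)"
    using along_compose[OF curve(3) smooth_G S0, of "\<lambda>_. 1"] D_0
    by (simp add: \<gamma>_0 p standard_0)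
  also have "along (\<lambda>_. 1) (\<lambda>t. standard_cuspidal_edge (\<Phi> (\<gamma> t))) 0 = vector [a, 0, 0]"
    using along_standard_cuspidal_edge[OF curve(1) smooth_on_const[of S 1] curve(2) S0]
    by (simp add: \<gamma>_0 p v)
  finally show "n = L (vector [a, 0, 0])" .
qed

lemma linear_L: "linear L" and inj_L: "inj L"
  using linear_DG inj_DG D_0 by auto

lemma n_nonzero: "n \<noteq> 0"
proof
  assume "n = 0"
  then have "L (vector [a, 0, 0]) = L 0"
    using n_eq linear_0[OF linear_L] by simp
  then have "(vector [a, 0, 0] :: real^3) = 0"
    by (rule injD[OF inj_L])
  then have "a = 0"
    by (metis vector_3(1) zero_index)
  then show False
    using a_nonzero by simp
qed

text \<open>Both the parameter derivative of a section curve and the derivative along a null vector field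
  are instances of \<open>along \<eta>\<close> with \<open>w = (u, v)\<close> where the first derivative of \<open>u\<close> vanishes.\<close>

lemma
  fixes w :: "'b::euclidean_space \<Rightarrow> real^2"
  assumes "open S" "smooth_on S \<eta>" "smooth_on S w" "x \<in> S" "w x = 0"
    and "(\<lambda>x. standard_cuspidal_edge (w x)) ` S \<subseteq> D"
  defines "F \<equiv> \<lambda>x. G (standard_cuspidal_edge (w x))"
  shows smooth_on_G_standard: "smooth_on S F"
    and along_G_standard: "along \<eta> F x = (along \<eta> w x $ 1 / a) *\<^sub>R n"
    and along_G_standard_eq_0: "along \<eta> F x = 0 \<Longrightarrow> along \<eta> w x $ 1 = 0"
    and along2_G_standard: "along \<eta> w x $ 1 = 0 \<Longrightarrow> along \<eta> (along \<eta> F) x =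
      L (vector [along \<eta> (along \<eta> w) x $ 1, 2 * (along \<eta> w x $ 2)\<^sup>2, 0])"
    and along3_G_standard: "along \<eta> w x $ 1 = 0 \<Longrightarrow> along \<eta> (along \<eta> (along \<eta> F)) x =
      L (vector [along \<eta> (along \<eta> (along \<eta> w)) x $ 1,
        6 * (along \<eta> w x $ 2) * (along \<eta> (along \<eta> w) x $ 2), 6 * (along \<eta> w x $ 2) ^ 3])"
proof -
  have w2: "w x $ 2 = 0"
    using assms(5) by simp
  note sZ = smooth_on_standard_cuspidal_edge[OF assms(1,3)]
  show "smooth_on S F"
    unfolding F_def by (rule smooth_on_compose[OF assms(1) open_D assms(6) sZ smooth_G])
  have Z0: "standard_cuspidal_edge (w x) = 0"
    using assms(5) standard_0 by simp
  note Z = along_standard_cuspidal_edge[OF assms(1-4) w2]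
  have "along \<eta> F x = L (vector [along \<eta> w x $ 1, 0, 0])"
    using along_compose[OF sZ smooth_G assms(4), of \<eta>] D_0 unfolding F_def Z0 Z by simp
  also have "(vector [along \<eta> w x $ 1, 0, 0] :: real^3) = (along \<eta> w x $ 1 / a) *\<^sub>R vector [a, 0, 0]"
    using a_nonzero by (intro vec3_eqI) simp_all
  finally show e: "along \<eta> F x = (along \<eta> w x $ 1 / a) *\<^sub>R n"
    using linear_scale[OF linear_L] n_eq by simp
  show "along \<eta> w x $ 1 = 0" if "along \<eta> F x = 0"
    using that e n_nonzero a_nonzero by simp
  assume "along \<eta> w x $ 1 = 0"
  then have Z1: "along \<eta> (\<lambda>x. standard_cuspidal_edge (w x)) x = 0"
    unfolding Z by (intro vec3_eqI) simp_all
  show "along \<eta> (along \<eta> F) x =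
      L (vector [along \<eta> (along \<eta> w) x $ 1, 2 * (along \<eta> w x $ 2)\<^sup>2, 0])"
    using along2_compose[OF assms(1) open_D assms(2) sZ smooth_G assms(6,4) Z1]
    unfolding F_def Z0 along2_standard_cuspidal_edge[OF assms(1-4) w2] .
  show "along \<eta> (along \<eta> (along \<eta> F)) x =
      L (vector [along \<eta> (along \<eta> (along \<eta> w)) x $ 1,
        6 * (along \<eta> w x $ 2) * (along \<eta> (along \<eta> w) x $ 2), 6 * (along \<eta> w x $ 2) ^ 3])"
    using along3_compose[OF assms(1) open_D assms(2) sZ smooth_G assms(6,4) Z1]
    unfolding F_def Z0 along3_standard_cuspidal_edge[OF assms(1-4) w2] .
qed

section \<open>A section curve: its cusp and its curvature\<close>

context
  fixes J :: "real set" and c :: "real \<Rightarrow> 'a" and U :: "'a set" and \<phi> :: "'a \<Rightarrow> real^2"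
    and P :: "(real^3) set"
  assumes sec: "section_curve M \<A> f \<gamma> P J c" and P: "P = plane_through (f p) n"
    and ch: "(U, \<phi>) \<in> \<A>" "p \<in> U"
begin

abbreviation "S \<equiv> J \<inter> c -` (U \<inter> W)"
abbreviation "w \<equiv> \<lambda>t. \<Phi> (c t)"
abbreviation "\<sigma> \<equiv> \<lambda>t. f (c t)"

lemma regular_c: "regular_curve M \<A> J c" and J_0: "0 \<in> J" and c_0: "c 0 = p"
  and orient_c: "positively_oriented_curves \<A> \<gamma> c" and in_P: "t \<in> J \<Longrightarrow> f (c t) \<in> P"
  using sec \<gamma>_0 by (auto simp: section_curve_def)

lemma S_0: "0 \<in> S"
  using J_0 c_0 p(1) ch by simp

lemmas open_S = open_curve_preimage[OF ch(1) regular_c]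
lemmas smooth_\<sigma> = smooth_on_image_curve[OF ch(1) regular_c]
lemmas smooth_w = smooth_on_coordinate_curve[OF ch(1) regular_c]

lemma standard_w_in: "(\<lambda>t. standard_cuspidal_edge (w t)) ` S \<subseteq> D"
  using standard_in_D by auto

lemma \<sigma>_eq: "t \<in> S \<Longrightarrow> \<sigma> t = G (standard_cuspidal_edge (w t))"
  by (simp add: f_eq_G)

lemma w_0: "w 0 = 0"
  using c_0 p by simp

lemma along_\<sigma>: "(along (\<lambda>_. 1) ^^ k) \<sigma> 0 =
    (along (\<lambda>_. 1) ^^ k) (\<lambda>t. G (standard_cuspidal_edge (w t))) 0"
  using along_power_cong[OF open_S smooth_on_const[of S 1]
      smooth_on_G_standard[OF open_S smooth_on_const[of S 1] smooth_w S_0 w_0 standard_w_in]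
      \<sigma>_eq[symmetric] S_0] .

text \<open>\<open>\<sigma> t \<bullet> n\<close> is constant because \<open>\<sigma>\<close> stays
  in \<open>P\<close>. Writing the order as \<open>Suc k\<close> excludes order zero, where the
  constant \<open>f p \<bullet> n\<close> itself would appear.\<close>

lemma along_\<sigma>_orthogonal: "(along (\<lambda>_. 1) ^^ Suc k) \<sigma> 0 \<bullet> n = 0"
proof -
  have "(along (\<lambda>_. 1) ^^ Suc k) (\<lambda>t. \<sigma> t \<bullet> n) 0 = (along (\<lambda>_. 1) ^^ Suc k) (\<lambda>t. f p \<bullet> n) (0::real)"
  proof (rule along_power_cong[OF open_S smooth_on_const smooth_on_const _ S_0])
    show "f p \<bullet> n = \<sigma> t \<bullet> n" if "t \<in> S" for t
      using in_P[of t] that by (simp add: P plane_through_def inner_diff_left)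
  qed
  also have "\<dots> = 0"
    by (induction k) (simp_all add: fun_eq_iff funpow_Suc_right del: funpow.simps)
  finally show ?thesis
    using along_power_linear[OF bounded_linear_inner_left[of n] open_S smooth_on_const[of S 1] smooth_\<sigma> S_0,
        where k = "Suc k"]
    by (simp del: funpow.simps)
qed

text \<open>The first derivative of \<open>\<sigma>\<close> at \<open>0\<close> is a multiple of
  \<open>n\<close> by the normal form and orthogonal to \<open>n\<close> by membership in
  \<open>P\<close>. Hence the \<open>u\<close>-component of the velocity is zero, and regularity of
  \<open>c\<close> makes the \<open>v\<close>-component non-zero.\<close>

lemma section_velocity: "along (\<lambda>_. 1) w 0 $ 1 = 0" and section_velocity_nonzero: "along (\<lambda>_. 1) w 0 $ 2 \<noteq> 0"
proof -
  have "((along (\<lambda>_. 1) w 0 $ 1 / a) *\<^sub>R n) \<bullet> n = 0"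
    using along_\<sigma>_orthogonal[of 0] along_\<sigma>[of 1]
      along_G_standard[OF open_S smooth_on_const[of S 1] smooth_w S_0 w_0 standard_w_in] by simp
  then show w1: "along (\<lambda>_. 1) w 0 $ 1 = 0"
    using a_nonzero n_nonzero by simp
  have "along (\<lambda>_. 1) w 0 \<noteq> 0"
    using coordinate_curve_velocity[OF ch(1) regular_c S_0]
      chart_curve_velocity_nonzero[OF ch(1) regular_c S_0] DT_nonzero[OF ch p(1)]
    by (simp add: c_0)
  then show "along (\<lambda>_. 1) w 0 $ 2 \<noteq> 0"
    using w1 by (auto simp: vec_eq_iff forall_2)
qed

abbreviation "b \<equiv> along (\<lambda>_. 1) w 0 $ 2"

lemma section_derivatives:
  obtains u u' v' where
    "along (\<lambda>_. 1) \<sigma> 0 = 0"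
    "(along (\<lambda>_. 1) ^^ 2) \<sigma> 0 = L (vector [u, 2 * b\<^sup>2, 0])"
    "(along (\<lambda>_. 1) ^^ 3) \<sigma> 0 = L (vector [u', v', 6 * b ^ 3])"
proof -
  note w = open_S smooth_on_const[of S 1] smooth_w S_0 w_0 standard_w_in
  show thesis
    using that[OF _ trans[OF along_\<sigma>[of 2]] trans[OF along_\<sigma>[of 3]]] along_\<sigma>[of 1]
      along_G_standard[OF w] along2_G_standard[OF w section_velocity] along3_G_standard[OF w section_velocity]
    by (simp add: section_velocity eval_nat_numeral)
qed

text \<open>Plane coordinates are a linear map \<open>Q\<close> plus a constant. For
  \<open>k > 0\<close> one derivative removes the constant, and all derivatives then pass through
  \<open>Q\<close>.\<close>

lemma plane_coords_derivatives:
  assumes "k > 0"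
  shows "(curve_derivative ^^ k) (plane_coords (f p) e1 e2 \<circ> (f \<circ> c)) 0 =
    vector [(along (\<lambda>_. 1) ^^ k) \<sigma> 0 \<bullet> e1, (along (\<lambda>_. 1) ^^ k) \<sigma> 0 \<bullet> e2]" (is ?thesis1)
    and "smooth_on S (plane_coords (f p) e1 e2 \<circ> (f \<circ> c))" (is ?thesis2)
proof -
  let ?s = "plane_coords (f p) e1 e2 \<circ> (f \<circ> c)"
  define Q where "Q y = (vector [y \<bullet> e1, y \<bullet> e2] :: real^2)" for y :: "real^3"
  have "linear Q"
    by (rule linearI) (simp_all add: Q_def vec_eq_iff forall_2 inner_add_left)
  then have Q: "bounded_linear Q"
    by (rule linear_conv_bounded_linear[THEN iffD1])
  have s: "?s = (\<lambda>t. Q (\<sigma> t) + Q (- f p))"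
    by (simp add: fun_eq_iff plane_coords_def Q_def vec_eq_iff forall_2 inner_diff_left)
  have sQ: "smooth_on S (\<lambda>t. Q (\<sigma> t))"
    by (rule smooth_on_linear[OF Q open_S smooth_\<sigma>])
  show ss: ?thesis2
    unfolding s by (intro smooth_on_add open_S sQ smooth_on_const)
  have one: "along (\<lambda>_. 1) (\<lambda>t. Q (\<sigma> t)) t = along (\<lambda>_. 1) ?s t" if "t \<in> S" for t
    using along_add[OF sQ smooth_on_const that, of "\<lambda>_. 1" "Q (- f p)"] unfolding s by simp
  obtain j where k: "k = Suc j"
    using assms gr0_conv_Suc by blast
  have "(curve_derivative ^^ k) ?s 0 = (along (\<lambda>_. 1) ^^ k) ?s 0"
    by (rule curve_derivative_power_eq_along[OF open_S ss S_0])
  also have "\<dots> = (along (\<lambda>_. 1) ^^ j) (along (\<lambda>_. 1) ?s) 0"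
    by (simp only: k funpow_Suc_right o_apply)
  also have "\<dots> = (along (\<lambda>_. 1) ^^ j) (along (\<lambda>_. 1) (\<lambda>t. Q (\<sigma> t))) 0"
    by (rule along_power_cong[OF open_S smooth_on_const smooth_on_along[OF open_S smooth_on_const sQ] one S_0])
  also have "\<dots> = (along (\<lambda>_. 1) ^^ k) (\<lambda>t. Q (\<sigma> t)) 0"
    by (simp only: k funpow_Suc_right o_apply)
  also have "\<dots> = Q ((along (\<lambda>_. 1) ^^ k) \<sigma> 0)"
    by (rule along_power_linear[OF Q open_S smooth_on_const smooth_\<sigma> S_0])
  finally show ?thesis1
    by (simp add: Q_def)
qed

lemma section_det_nonzero:
  "det (vector [n, (along (\<lambda>_. 1) ^^ 2) \<sigma> 0, (along (\<lambda>_. 1) ^^ 3) \<sigma> 0] :: real^3^3) \<noteq> 0"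
proof -
  obtain u u' v' where
    "(along (\<lambda>_. 1) ^^ 2) \<sigma> 0 = L (vector [u, 2 * b\<^sup>2, 0])"
    "(along (\<lambda>_. 1) ^^ 3) \<sigma> 0 = L (vector [u', v', 6 * b ^ 3])"
    by (rule section_derivatives)
  then show ?thesis
    unfolding n_eq using det_image_basis_nonzero[OF linear_L inj_L] a_nonzero section_velocity_nonzero
    by (simp add: det_image_cusp_frame[OF linear_L])
qed

lemma section_three_half_cusp:
  assumes "positive_orthonormal_basis n e1 e2"
  shows "three_half_cusp (plane_coords (f p) e1 e2 \<circ> (f \<circ> c))"
  unfolding three_half_cusp_def
proof (intro conjI)
  obtain \<epsilon> where "\<epsilon> > 0" "ball 0 \<epsilon> \<subseteq> S"
    using open_S S_0 openE by metis
  then show "\<exists>\<epsilon>>0. smooth_on {-\<epsilon><..<\<epsilon>} (plane_coords (f p) e1 e2 \<circ> (f \<circ> c))"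
    using smooth_on_subset[OF plane_coords_derivatives(2)[OF zero_less_one]]
    by (metis ball_eq_greaterThanLessThan add_0 diff_0)
  show "curve_derivative (plane_coords (f p) e1 e2 \<circ> (f \<circ> c)) 0 = 0"
  proof -
    have "along (\<lambda>_. 1) \<sigma> 0 = 0"
      by (rule section_derivatives)
    with plane_coords_derivatives(1)[of 1 e1 e2] show ?thesis
      by (simp add: vec_eq_iff[where 'b = 2] forall_2)
  qed
  \<comment> \<open>The plane determinant times \<open>norm n\<close> is the space determinant
    \<open>section_det_nonzero\<close>.\<close>
  show "det (vector [(curve_derivative ^^ 2) (plane_coords (f p) e1 e2 \<circ> (f \<circ> c)) 0,
      (curve_derivative ^^ 3) (plane_coords (f p) e1 e2 \<circ> (f \<circ> c)) 0] :: real^2^2) \<noteq> 0"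
    using section_det_nonzero det_normal_plane[OF assms along_\<sigma>_orthogonal[of 1] along_\<sigma>_orthogonal[of 2]]
      plane_coords_derivatives(1)[of 2 e1 e2] plane_coords_derivatives(1)[of 3 e1 e2]
    by (simp add: numeral_2_eq_2 numeral_3_eq_3 del: funpow.simps)
qed

lemma section_curvature:
  assumes basis: "positive_orthonormal_basis n e1 e2"
    and null: "null_vector_field f \<gamma> (U, \<phi>) A \<eta>"
  shows "cuspidal_edge_curvature f \<gamma> (U, \<phi>) \<eta> 0 =
    plane_cuspidal_curvature (plane_coords (f p) e1 e2 \<circ> (f \<circ> c))"
proof -
  have A: "open A" "\<phi> p \<in> A" "smooth_on A \<eta>"
    using null \<gamma>_0 by (auto simp: null_vector_field_def)
  \<comment> \<open>A property that holds eventually in \<open>nhds 0\<close> holds at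
    \<open>0\<close> itself.\<close>
  have at0: "differential (U, \<phi>) f p (\<eta> (\<phi> p)) = 0"
    "positive_pair (vector_derivative (\<phi> \<circ> \<gamma>) (at 0)) (\<eta> (\<phi> p))"
    using null eventually_nhds_x_imp_x \<gamma>_0 unfolding null_vector_field_def
    by (force dest!: eventually_nhds_x_imp_x)+
  define B where "B = A \<inter> \<phi> ` (U \<inter> W)"
  have B: "open B" "\<phi> p \<in> B" "smooth_on B \<eta>" "smooth_on B (T U \<phi>)"
    using A open_\<phi>_image[OF ch(1)] p ch smooth_on_subset[OF A(3)] smooth_on_subset[OF smooth_T[OF ch(1)]]
    by (auto simp: B_def)
  have T0: "T U \<phi> (\<phi> p) = 0"
    using T_apply[OF ch] p by simp
  have inD: "(\<lambda>x. standard_cuspidal_edge (T U \<phi> x)) ` B \<subseteq> D"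
    using standard_T_in[OF ch(1)] by (auto simp: B_def simp del: o_apply)
  note w = B(1,3,4,2) T0 inD
  have g: "(along \<eta> ^^ k) (f \<circ> inv_into U \<phi>) (\<phi> p) =
      (along \<eta> ^^ k) (\<lambda>x. G (standard_cuspidal_edge (T U \<phi> x))) (\<phi> p)" for k
    by (rule along_power_cong[OF B(1,3) smooth_on_G_standard[OF w] _ B(2)])
      (use f_chart_eq[OF ch(1)] in \<open>auto simp: B_def\<close>)
  have "along \<eta> (\<lambda>x. G (standard_cuspidal_edge (T U \<phi> x))) (\<phi> p) = 0"
    using g[of 1] at0(1) by (simp add: along_def differential_def)
  \<comment> \<open>The null condition does here what membership in \<open>P\<close> does for the
    section curve: it removes the \<open>u\<close>-component of the direction.\<close>
  then have \<eta>1: "along \<eta> (T U \<phi>) (\<phi> p) $ 1 = 0"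
    by (rule along_G_standard_eq_0[OF w])
  define \<beta> where "\<beta> = along \<eta> (T U \<phi>) (\<phi> p) $ 2"
  define f2 where "f2 = (directional_derivative \<eta> ^^ 2) (f \<circ> inv_into U \<phi>) (\<phi> p)"
  define f3 where "f3 = (directional_derivative \<eta> ^^ 3) (f \<circ> inv_into U \<phi>) (\<phi> p)"
  obtain u u' v' where F: "f2 = L (vector [u, 2 * \<beta>\<^sup>2, 0])" "f3 = L (vector [u', v', 6 * \<beta> ^ 3])"
    using g[of 2] g[of 3] along2_G_standard[OF w \<eta>1] along3_G_standard[OF w \<eta>1]
    by (auto simp: f2_def f3_def directional_derivative_eq_along \<beta>_def eval_nat_numeral)
  let ?\<Lambda> = "frechet_derivative (T U \<phi>) (at (\<phi> p))"
  let ?\<gamma>' = "vector_derivative (\<phi> \<circ> \<gamma>) (at 0)" and ?c' = "vector_derivative (\<phi> \<circ> c) (at 0)"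
  have \<gamma>S: "0 \<in> I \<inter> \<gamma> -` (U \<inter> W)"
    using \<gamma>_0 p ch by simp
  have \<Lambda>\<gamma>: "?\<Lambda> ?\<gamma>' = vector [a, 0]"
    using coordinate_curve_velocity[OF ch(1) regular_\<gamma> \<gamma>S] chart_curve_velocity[OF ch(1) regular_\<gamma> \<gamma>S]
      singular_curve_velocity \<gamma>_0 by simp
  have \<Lambda>c: "?\<Lambda> ?c' = along (\<lambda>_. 1) w 0"
    using coordinate_curve_velocity[OF ch(1) regular_c S_0] chart_curve_velocity[OF ch(1) regular_c S_0]
      c_0 by simp
  have \<Lambda>\<eta>: "?\<Lambda> (\<eta> (\<phi> p)) = along \<eta> (T U \<phi>) (\<phi> p)"
    by (simp add: along_def)
  have "positive_pair ?\<gamma>' ?c'"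
    using orient_c ch \<gamma>_0 by (auto simp: positively_oriented_curves_def)
  \<comment> \<open>Both determinants are positive in the chart. In adapted coordinates they become
    \<open>a * b\<close> and \<open>a * \<beta>\<close>, each multiplied by the Jacobian determinant
    of \<open>T\<close>; its unknown sign drops out of the product.\<close>
  then have "det (vector [?\<gamma>', ?c'] :: real^2^2) * det (vector [?\<gamma>', \<eta> (\<phi> p)] :: real^2^2) > 0"
    using at0(2) by (simp add: positive_pair_def)
  moreover have ab: "a * b = det (matrix ?\<Lambda>) * det (vector [?\<gamma>', ?c'] :: real^2^2)"
    using det_vector_linear[OF linear_DT[OF ch p(1)], of ?\<gamma>' ?c'] by (simp add: \<Lambda>\<gamma> \<Lambda>c det_vector_2)
  moreover have "a * \<beta> = det (matrix ?\<Lambda>) * det (vector [?\<gamma>', \<eta> (\<phi> p)] :: real^2^2)"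
    using det_vector_linear[OF linear_DT[OF ch p(1)], of ?\<gamma>' "\<eta> (\<phi> p)"]
    by (simp add: \<Lambda>\<gamma> \<Lambda>\<eta> det_vector_2 \<beta>_def)
  moreover have "det (matrix ?\<Lambda>) \<noteq> 0"
    using ab a_nonzero section_velocity_nonzero by auto
  moreover have "x * y > 0 \<Longrightarrow> l \<noteq> 0 \<Longrightarrow> (l * x) * (l * y) > 0" for x y l :: real
  proof -
    assume "x * y > 0" "l \<noteq> 0"
    then have "l\<^sup>2 * (x * y) > 0"
      by simp
    then show ?thesis
      by (simp add: power2_eq_square mult_ac)
  qed
  ultimately have "(a * b) * (a * \<beta>) > 0"
    by metis
  moreover have "(a * b) * (a * \<beta>) = (a * a) * (b * \<beta>)"
    by simp
  moreover have "a * a > 0"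
    using a_nonzero by (auto simp: zero_less_mult_iff linorder_neq_iff)
  ultimately have b\<beta>: "b * \<beta> > 0"
    by (metis zero_less_mult_pos)
  \<comment> \<open>The section curve and the null field may cross the edge at different speeds;
    \<open>r\<close> is the ratio.\<close>
  define r where "r = b / \<beta>"
  have r: "r > 0" "b = r * \<beta>"
    using b\<beta> by (auto simp: r_def zero_less_mult_iff zero_less_divide_iff)
  obtain u1 u1' v1' where s:
    "(along (\<lambda>_. 1) ^^ 2) \<sigma> 0 = L (vector [u1, 2 * b\<^sup>2, 0])"
    "(along (\<lambda>_. 1) ^^ 3) \<sigma> 0 = L (vector [u1', v1', 6 * b ^ 3])"
    by (rule section_derivatives)
  let ?s2 = "(along (\<lambda>_. 1) ^^ 2) \<sigma> 0" and ?s3 = "(along (\<lambda>_. 1) ^^ 3) \<sigma> 0"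
  have det: "det (vector [n, ?s2, ?s3] :: real^3^3) = r ^ 5 * det (vector [n, f2, f3] :: real^3^3)"
    unfolding s F n_eq det_image_cusp_frame[OF linear_L] by (simp add: r(2) power_mult_distrib)
  have cross: "norm (cross3 n ?s2) = r\<^sup>2 * norm (cross3 n f2)"
    unfolding s F n_eq cross3_image_cusp_frame[OF linear_L]
    by (simp add: r(2) power_mult_distrib abs_mult)
  have orth: "?s2 \<bullet> n = 0" "?s3 \<bullet> n = 0"
    using along_\<sigma>_orthogonal[of 1] along_\<sigma>_orthogonal[of 2]
    by (simp_all add: numeral_2_eq_2 numeral_3_eq_3 del: funpow.simps)
  show ?thesis
    using cuspidal_curvature_section[OF basis orth n_nonzero r(1) det cross]
      plane_coords_derivatives(1)[of 2 e1 e2] plane_coords_derivatives(1)[of 3 e1 e2]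
    by (simp add: cuspidal_edge_curvature_def plane_cuspidal_curvature_def f2_def f3_def n \<gamma>_0 Let_def)
qed

end

section \<open>Existence of the section curve\<close>

lemma det_DT_sign:
  assumes "(U, \<phi>) \<in> \<A>" "p \<in> U" "(U', \<phi>') \<in> \<A>" "p \<in> U'"
  shows "sgn (det (matrix (frechet_derivative (T U \<phi>) (at (\<phi> p))))) =
    sgn (det (matrix (frechet_derivative (T U' \<phi>') (at (\<phi>' p)))))"
proof -
  \<comment> \<open>The two coordinate changes differ by the chart transition, whose Jacobian
    determinant is positive in the oriented atlas. A sign read off in one chart at \<open>p\<close>
    is therefore valid in all of them.\<close>
  let ?\<tau> = "\<phi>' \<circ> inv_into U \<phi>"
  have s\<tau>: "smooth_on (\<phi> ` (U \<inter> U')) ?\<tau>"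
    and pos: "det (matrix (frechet_derivative ?\<tau> (at (\<phi> p)))) > 0"
    using surface assms unfolding oriented_surface_def by blast+
  have \<tau>: "?\<tau> (\<phi> q) = \<phi>' q" if "q \<in> U" for q
    using homeo_chart[OF assms(1)] that by (simp add: homeomorphism_def)
  let ?B = "\<phi> ` (U \<inter> (U' \<inter> W))"
  have B: "open ?B" "\<phi> p \<in> ?B"
    using open_chart_image_Int[OF assms(1) open_Int[OF open_U[OF assms(3)] open_W]] assms p by auto
  have d\<tau>: "?\<tau> differentiable (at (\<phi> p))"
    using smooth_on_imp_differentiable[OF s\<tau>] assms by blast
  have dT: "T U \<phi> differentiable (at (\<phi> p))"
    using smooth_on_imp_differentiable[OF smooth_T[OF assms(1)]] assms p by blast
  have dT': "T U' \<phi>' differentiable (at (?\<tau> (\<phi> p)))"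
    unfolding \<tau>[OF assms(2)]
    using smooth_on_imp_differentiable[OF smooth_T[OF assms(3)]] assms p by blast
  have "T U \<phi> x = (T U' \<phi>' \<circ> ?\<tau>) x" if "x \<in> ?B" for x
  proof -
    obtain q where q: "x = \<phi> q" "q \<in> U" "q \<in> U'"
      using \<open>x \<in> ?B\<close> by blast
    show ?thesis
      unfolding q(1) o_apply[of "T U' \<phi>'"] \<tau>[OF q(2)] T_apply[OF assms(3) q(3)] T_apply[OF assms(1) q(2)] ..
  qed
  then have "frechet_derivative (T U \<phi>) (at (\<phi> p)) = frechet_derivative (T U' \<phi>' \<circ> ?\<tau>) (at (\<phi> p))"
    using frechet_derivative_transform_within_open[OF dT B] by blast
  also have "\<dots> = frechet_derivative (T U' \<phi>') (at (\<phi>' p)) \<circ> frechet_derivative ?\<tau> (at (\<phi> p))"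
    using frechet_derivative_compose[OF d\<tau> dT'] by (simp only: \<tau>[OF assms(2)])
  finally have "matrix (frechet_derivative (T U \<phi>) (at (\<phi> p))) =
      matrix (frechet_derivative (T U' \<phi>') (at (\<phi>' p))) ** matrix (frechet_derivative ?\<tau> (at (\<phi> p)))"
    using matrix_compose[OF linear_frechet_derivative[OF d\<tau>] linear_frechet_derivative[OF dT']]
    by (simp only: \<tau>[OF assms(2)])
  then show ?thesis
    using pos by (simp add: det_mul sgn_mult)
qed

lemma section_curve_exists:
  assumes "open N" "p \<in> N" and P: "P = plane_through (f p) n"
  shows "\<exists>U J c. open U \<and> p \<in> U \<and> U \<subseteq> N \<inter> M \<and> section_curve M \<A> f \<gamma> P J c \<and> c ` J \<subseteq> U \<and>
    P \<inter> f ` U = (f \<circ> c) ` J"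
proof -
  obtain U0 \<phi>0 where ch: "(U0, \<phi>0) \<in> \<A>" "p \<in> U0"
    by (rule chart_at_p)
  let ?\<kappa> = "inv_into W \<Phi>" and ?T = "T U0 \<phi>0" and ?T' = "T' \<phi>0"
  have \<kappa>: "?\<kappa> (\<Phi> q) = q" if "q \<in> W" for q
    using inj_\<Phi> that by simp
  define Q where "Q = \<Phi> ` (U0 \<inter> W)"
  have Q: "open Q"
    unfolding Q_def by (rule open_\<Phi>_image[OF ch(1)])
  \<comment> \<open>On \<open>Q\<close> the inverse of \<open>\<Phi>\<close> factors through the
    smooth \<open>T'\<close> and the inverse of the chart, which makes it continuous.\<close>
  have "continuous_on Q (\<lambda>y. inv_into U0 \<phi>0 (?T' y))"
  proof (rule continuous_on_compose2[OF homeomorphism_cont2[OF homeo_chart[OF ch(1)]]])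
    show "continuous_on Q ?T'"
      unfolding Q_def by (rule smooth_on_imp_continuous_on[OF smooth_T'[OF ch(1)]])
    show "?T' ` Q \<subseteq> \<phi>0 ` U0"
      using T'_apply[OF ch(1)] by (auto simp: Q_def simp del: o_apply)
  qed
  then have cont\<kappa>: "continuous_on Q ?\<kappa>"
    by (rule continuous_on_eq)
      (use T'_apply[OF ch(1)] homeo_chart[OF ch(1)] \<kappa> in \<open>auto simp: Q_def homeomorphism_def\<close>)
  have "continuous_on (U0 \<inter> W) (\<lambda>q. ?T (\<phi>0 q))"
    by (rule continuous_on_compose2[OF smooth_on_imp_continuous_on[OF smooth_T[OF ch(1)]]])
      (auto intro: continuous_on_subset[OF homeomorphism_cont1[OF homeo_chart[OF ch(1)]]])
  then have cont\<Phi>: "continuous_on (U0 \<inter> W) \<Phi>"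
    by (rule continuous_on_eq) (use T_apply[OF ch(1)] in auto)
  \<comment> \<open>Coordinates of the points common to \<open>U0\<close>, \<open>W\<close> and
    \<open>N\<close>; staying in \<open>E\<close> keeps the curve in the prescribed
    neighborhood.\<close>
  define E where "E = Q \<inter> ?\<kappa> -` N"
  have E: "open E" "0 \<in> E"
  proof -
    show "open E"
      using continuous_on_open_vimage[OF Q, of ?\<kappa>] cont\<kappa> assms(1) by (auto simp: E_def Int_commute)
    have "0 \<in> Q"
      using p ch by (force simp: Q_def)
    moreover have "?\<kappa> 0 = p"
      using \<kappa>[OF p(1)] p(2) by simp
    ultimately show "0 \<in> E"
      using assms(2) by (simp add: E_def)
  qed
  have E_cases: "\<exists>q. y = \<Phi> q \<and> q \<in> U0 \<and> q \<in> W \<and> q \<in> N" if "y \<in> E" for y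
    using that \<kappa> by (auto simp: E_def Q_def)
  let ?F = "\<lambda>y. G (standard_cuspidal_edge y)"
  have inD: "standard_cuspidal_edge ` E \<subseteq> D"
    using E_cases standard_in_D by blast
  have sF: "smooth_on E ?F"
    by (rule smooth_on_compose[OF E(1) open_D inD smooth_on_standard_cuspidal_edge[OF E(1) smooth_on_id] smooth_G])
  have Fp: "G (standard_cuspidal_edge 0) = f p"
    using f_eq_G[OF p(1)] p(2) by simp
  define h where "h y = (?F y - f p) \<bullet> n" for y
  have h_eq: "h = (\<lambda>y. ?F y \<bullet> n + (- (f p \<bullet> n)))"
    by (simp add: h_def inner_diff_left fun_eq_iff)
  have sFn: "smooth_on E (\<lambda>y. ?F y \<bullet> n)"
    by (rule smooth_on_inner_left[OF E(1) sF])
  have sh: "smooth_on E h"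
    unfolding h_eq by (rule smooth_on_add[OF E(1) sFn smooth_on_const])
  have h0: "h 0 = 0"
    by (simp add: h_def Fp)
  \<comment> \<open>Transversality of \<open>P\<close> to the edge: the differential of
    \<open>?F\<close> sends the \<open>u\<close>-direction to \<open>n / a\<close>, whose inner
    product with \<open>n\<close> is non-zero.\<close>
  have hu: "frechet_derivative h (at 0) (axis 1 1) \<noteq> 0"
  proof -
    let ?e = "\<lambda>_ :: real^2. axis 1 (1::real) :: real^2"
    have "along ?e h 0 = along ?e (\<lambda>y. ?F y \<bullet> n) 0"
      unfolding h_eq along_add[OF sFn smooth_on_const E(2)] by simp
    also have "\<dots> = along ?e ?F 0 \<bullet> n"
      by (rule along_linear[OF bounded_linear_inner_left sF E(2)])
    also have "along ?e ?F 0 = (1 / a) *\<^sub>R n"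
      using along_G_standard[OF E(1) smooth_on_const smooth_on_id E(2) refl inD, of "axis 1 1"]
      by (simp add: along_id axis_def)
    finally show ?thesis
      using a_nonzero n_nonzero by (simp add: along_def)
  qed
  have det_nz: "det (matrix (frechet_derivative (T U \<phi>) (at (\<phi> p)))) \<noteq> 0"
    if "(U, \<phi>) \<in> \<A>" "p \<in> U" for U \<phi>
    using det_nz_iff_inj[OF linear_DT[OF that p(1)]] DT_inverse(1)[OF that p(1)]
    by (metis inj_on_inverseI)
  \<comment> \<open>In adapted coordinates the velocities of \<open>\<gamma>\<close> and of a curve
    with \<open>v = s * t\<close> have determinant \<open>a * s\<close>. This \<open>s\<close> gives
    it the sign of the Jacobian determinant of \<open>?T\<close>, which makes the pair positive in
    the chart.\<close>
  define s where "s = sgn (a * det (matrix (frechet_derivative ?T (at (\<phi>0 p)))))"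
  have s: "s = 1 \<or> s = -1"
    using det_nz[OF ch] a_nonzero by (auto simp: s_def sgn_if)
  obtain E' \<epsilon> w where E': "open E'" "0 \<in> E'" "E' \<subseteq> E" and \<epsilon>: "\<epsilon> > 0"
    and sw: "smooth_on {-\<epsilon><..<\<epsilon>} w" and w0: "w 0 = 0"
    and w: "\<And>t. t \<in> {-\<epsilon><..<\<epsilon>} \<Longrightarrow> w t \<in> E' \<and> h (w t) = 0 \<and> w t $ 2 = s * t"
    and w_unique: "\<And>y. y \<in> E' \<Longrightarrow> h y = 0 \<Longrightarrow> \<bar>y $ 2\<bar> < \<epsilon> \<Longrightarrow> w (s * y $ 2) = y"
    by (rule smooth_implicit_curve[OF E sh h0 hu s]) blast
  define J where "J = {-\<epsilon><..<\<epsilon>}"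
  define c where "c t = ?\<kappa> (w t)" for t
  have J: "open J" "0 \<in> J"
    using \<epsilon> by (auto simp: J_def)
  have c: "c t \<in> U0 \<and> c t \<in> W \<and> c t \<in> N \<and> \<Phi> (c t) = w t" if "t \<in> J" for t
  proof -
    have "w t \<in> E"
      using w[of t] E'(3) that by (auto simp: J_def)
    then obtain q where "w t = \<Phi> q" "q \<in> U0" "q \<in> W" "q \<in> N"
      using E_cases by blast
    then show ?thesis
      using \<kappa> by (simp add: c_def)
  qed
  have c0: "c 0 = p"
    using \<kappa>[OF p(1)] p(2) by (simp add: c_def w0)
  have "continuous_on J c"
    unfolding c_def[abs_def]
    by (rule continuous_on_compose2[OF cont\<kappa>])
      (use smooth_on_imp_continuous_on[OF sw] w E'(3) in \<open>auto simp: J_def E_def\<close>)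
  note contc = this
  have w': "along (\<lambda>_. 1) w t $ 2 = s" if "t \<in> J" for t
  proof -
    have "along (\<lambda>_. 1) w t $ 2 = along (\<lambda>_. 1) (\<lambda>t. w t $ 2) t"
      using along_linear[OF bounded_linear_vec_nth sw, of t "\<lambda>_. 1" 2] that by (simp add: J_def)
    also have "\<dots> = along (\<lambda>_. 1) (\<lambda>t. s * t) t"
      by (rule along_cong[OF J(1) that])
        (use w in \<open>auto simp: J_def intro!: smooth_on_mult smooth_on_const smooth_on_id\<close>)
    also have "\<dots> = s"
    proof -
      have "((\<lambda>t. s * t) has_derivative (\<lambda>t. s * t)) (at t)"
        by (rule has_derivative_mult_right[OF has_derivative_ident])
      from along_eqI[OF this, of "\<lambda>_. 1"] show ?thesis
        by simp
    qed
    finally show ?thesis .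
  qed
  have chart_curve: "smooth_on (J \<inter> c -` U) (\<phi> \<circ> c)"
    "\<And>t. t \<in> J \<inter> c -` U \<Longrightarrow> vector_derivative (\<phi> \<circ> c) (at t) =
      frechet_derivative (T' \<phi>) (at (w t)) (along (\<lambda>_. 1) w t)"
    if ch': "(U, \<phi>) \<in> \<A>" for U \<phi>
  proof -
    let ?S = "J \<inter> c -` U"
    have S: "open ?S"
      using continuous_on_open_vimage[OF J(1), of c] contc open_U[OF ch'] by (auto simp: Int_commute)
    have sub: "w ` ?S \<subseteq> \<Phi> ` (U \<inter> W)"
      using c by (force simp: image_iff)
    have sw': "smooth_on ?S w"
      by (rule smooth_on_subset[OF sw]) (auto simp: J_def)
    have sT: "smooth_on ?S (\<lambda>t. T' \<phi> (w t))"
      by (rule smooth_on_compose[OF S open_\<Phi>_image[OF ch'] sub sw' smooth_T'[OF ch']])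
    have e: "T' \<phi> (w t) = (\<phi> \<circ> c) t" if "t \<in> ?S" for t
      by (simp add: c_def)
    show sc: "smooth_on ?S (\<phi> \<circ> c)"
      by (rule smooth_on_cong[OF S e sT])
    fix t assume t: "t \<in> ?S"
    have "vector_derivative (\<phi> \<circ> c) (at t) = along (\<lambda>_. 1) (\<phi> \<circ> c) t"
      by (rule curve_derivative_eq_along[OF smooth_on_imp_differentiable[OF sc t]])
    also have "\<dots> = along (\<lambda>_. 1) (\<lambda>t. T' \<phi> (w t)) t"
      by (rule along_cong[OF S t sT e])
    also have "\<dots> = frechet_derivative (T' \<phi>) (at (w t)) (along (\<lambda>_. 1) w t)"
      using sub t by (intro along_compose[OF sw' smooth_T'[OF ch'] t]) auto
    finally show "vector_derivative (\<phi> \<circ> c) (at t) =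
      frechet_derivative (T' \<phi>) (at (w t)) (along (\<lambda>_. 1) w t)" .
  qed
  have regular: "regular_curve M \<A> J c"
    unfolding regular_curve_def
  proof (intro conjI ballI)
    show "is_interval J"
      by (simp add: J_def is_interval_oo)
    show "c ` J \<subseteq> M"
      using c coords by (auto simp: local_coordinates_def)
    fix z assume z: "z \<in> \<A>"
    obtain U \<phi> where zU: "z = (U, \<phi>)"
      by fastforce
    have ch': "(U, \<phi>) \<in> \<A>"
      using z zU by simp
    \<comment> \<open>A vanishing velocity in the chart would make the velocity in adapted
      coordinates vanish, whereas its second component is \<open>s\<close>.\<close>
    have "vector_derivative (\<phi> \<circ> c) (at t) \<noteq> 0" if t: "t \<in> J \<inter> c -` U" for t
    proof
      assume "vector_derivative (\<phi> \<circ> c) (at t) = 0"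
      then have "frechet_derivative (T' \<phi>) (at (\<Phi> (c t))) (along (\<lambda>_. 1) w t) = 0"
        using chart_curve(2)[OF ch' t] c t by simp
      moreover have ct: "c t \<in> U" "c t \<in> W"
        using c t by auto
      ultimately have "along (\<lambda>_. 1) w t = 0"
        using DT_inverse(2)[OF ch' ct, of "along (\<lambda>_. 1) w t"] linear_0[OF linear_DT[OF ch' ct]] by simp
      then show False
        using w'[of t] s t by auto
    qed
    then show "case z of (U, \<phi>) \<Rightarrow> smooth_on (J \<inter> c -` U) (\<phi> \<circ> c) \<and>
        (\<forall>t\<in>J \<inter> c -` U. vector_derivative (\<phi> \<circ> c) (at t) \<noteq> 0)"
      using chart_curve(1)[OF ch'] zU by simp
  qed (use J contc in auto)
  have oriented: "positively_oriented_curves \<A> \<gamma> c"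
    unfolding positively_oriented_curves_def
  proof clarify
    fix U \<phi> assume ch': "(U, \<phi>) \<in> \<A>" and "\<gamma> 0 \<in> U"
    then have pU: "p \<in> U"
      by (simp add: \<gamma>_0)
    let ?\<Lambda> = "frechet_derivative (T U \<phi>) (at (\<phi> p))"
    let ?\<gamma>' = "vector_derivative (\<phi> \<circ> \<gamma>) (at 0)" and ?c' = "vector_derivative (\<phi> \<circ> c) (at 0)"
    have \<gamma>S: "0 \<in> I \<inter> \<gamma> -` (U \<inter> W)"
      using \<gamma>_0 p pU by simp
    have \<Lambda>\<gamma>: "?\<Lambda> ?\<gamma>' = vector [a, 0]"
      using coordinate_curve_velocity[OF ch' regular_\<gamma> \<gamma>S] chart_curve_velocity[OF ch' regular_\<gamma> \<gamma>S]
        singular_curve_velocity \<gamma>_0 by simp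
    have "?c' = frechet_derivative (T' \<phi>) (at (\<Phi> p)) (along (\<lambda>_. 1) w 0)"
      using chart_curve(2)[OF ch', of 0] J(2) c0 pU w0 p(2) by simp
    then have "?\<Lambda> ?c' = along (\<lambda>_. 1) w 0"
      using DT_inverse(2)[OF ch' pU p(1)] by simp
    then have "det (matrix ?\<Lambda>) * det (vector [?\<gamma>', ?c'] :: real^2^2) = a * s"
      using det_vector_linear[OF linear_DT[OF ch' pU p(1)], of ?\<gamma>' ?c'] \<Lambda>\<gamma> w'[OF J(2)]
      by (simp add: det_vector_2)
    then have "sgn (det (matrix ?\<Lambda>)) * sgn (det (vector [?\<gamma>', ?c'] :: real^2^2)) = sgn a * sgn s"
      by (metis sgn_mult)
    also have "sgn s = sgn a * sgn (det (matrix ?\<Lambda>))"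
      using det_DT_sign[OF ch ch' pU] by (simp add: s_def sgn_mult)
    finally have eq: "sgn (det (matrix ?\<Lambda>)) * sgn (det (vector [?\<gamma>', ?c'] :: real^2^2)) =
        sgn a * (sgn a * sgn (det (matrix ?\<Lambda>)))" .
    have "sgn d = 1" if "sgn l * sgn d = sgn a * (sgn a * sgn l)" "l \<noteq> 0" for l d :: real
      using that a_nonzero by (auto simp: sgn_if split: if_splits)
    from this[OF eq det_nz[OF ch' pU]] have "sgn (det (vector [?\<gamma>', ?c'] :: real^2^2)) = 1" .
    then show "positive_pair ?\<gamma>' ?c'"
      by (simp add: positive_pair_def sgn_1_pos)
  qed
  have in_P: "f q \<in> P \<longleftrightarrow> h (\<Phi> q) = 0" if "q \<in> W" for q
    using f_eq_G[OF that] by (simp add: P plane_through_def h_def)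
  \<comment> \<open>The bound on the second coordinate matches the parameter interval, so the
    uniqueness clause of the implicit curve reaches every point of \<open>U\<close> that
    \<open>f\<close> maps into \<open>P\<close>.\<close>
  define U where "U = (U0 \<inter> W) \<inter> \<Phi> -` (E' \<inter> {y. \<bar>y $ 2\<bar> < \<epsilon>})"
  have U_N: "q \<in> U0 \<and> q \<in> W \<and> q \<in> N \<and> \<Phi> q \<in> E' \<and> \<bar>\<Phi> q $ 2\<bar> < \<epsilon>" if "q \<in> U" for q
  proof -
    have q: "q \<in> U0" "q \<in> W" "\<Phi> q \<in> E'" "\<bar>\<Phi> q $ 2\<bar> < \<epsilon>"
      using that by (auto simp: U_def)
    then obtain q' where "\<Phi> q = \<Phi> q'" "q' \<in> W" "q' \<in> N"
      using E_cases[of "\<Phi> q"] E'(3) by blast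
    then have "q \<in> N"
      using inj_onD[OF inj_\<Phi>] q(2) by metis
    then show ?thesis
      using q by simp
  qed
  show ?thesis
  proof (intro exI conjI)
    have "open (E' \<inter> {y. \<bar>y $ 2\<bar> < \<epsilon>})"
      using E'(1) by (intro open_Int open_Collect_less continuous_intros)
    then show "open U"
      using continuous_on_open_vimage[of "U0 \<inter> W" \<Phi>] cont\<Phi> open_Int[OF open_U[OF ch(1)] open_W]
      by (auto simp: U_def Int_commute)
    show "p \<in> U"
      using p ch E'(2) \<epsilon> by (simp add: U_def)
    show "U \<subseteq> N \<inter> M"
      using U_N coords by (auto simp: local_coordinates_def)
    have cU: "c t \<in> U" if "t \<in> J" for t
      using c[OF that] w[of t] s that by (auto simp: U_def J_def abs_mult)
    then show "c ` J \<subseteq> U"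
      by blast
    have fP: "f (c t) \<in> P" if "t \<in> J" for t
      using in_P[of "c t"] c[OF that] w[of t] that by (simp add: J_def)
    then show "section_curve M \<A> f \<gamma> P J c"
      using regular oriented J(2) c0 \<gamma>_0 by (auto simp: section_curve_def)
    show "P \<inter> f ` U = (f \<circ> c) ` J"
    proof
      show "(f \<circ> c) ` J \<subseteq> P \<inter> f ` U"
        using fP cU by auto
      show "P \<inter> f ` U \<subseteq> (f \<circ> c) ` J"
      proof clarify
        fix q assume q: "q \<in> U" "f q \<in> P"
        \<comment> \<open>Since \<open>s * s = 1\<close>, this parameter solves
          \<open>s * ?t = \<Phi> q $ 2\<close>.\<close>
        let ?t = "s * \<Phi> q $ 2"
        have "w ?t = \<Phi> q"
          using w_unique[of "\<Phi> q"] U_N[OF q(1)] in_P[of q] q(2) by blast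
        then have "c ?t = q"
          using U_N[OF q(1)] \<kappa> by (simp add: c_def)
        moreover have "?t \<in> J"
          using U_N[OF q(1)] s by (auto simp: J_def)
        ultimately show "f q \<in> (f \<circ> c) ` J"
          by (metis comp_apply imageI)
      qed
    qed
  qed
qed

end

theorem proposition2p1:
  fixes M :: "'a::{t2_space,second_countable_topology} set"
    and \<A> :: "'a chart2 set"
    and f :: "'a \<Rightarrow> real^3"
    and p :: 'a
    and I :: "real set"
    and \<gamma> :: "real \<Rightarrow> 'a"
    and n :: "real^3"
    and P :: "(real^3) set"
  assumes "oriented_surface M \<A>"
    and "front M \<A> f"
    and "cuspidal_edge M \<A> f p"
    and "singular_curve M \<A> f p I \<gamma>"
    and "n = vector_derivative (f \<circ> \<gamma>) (at 0)"
    and "P = plane_through (f p) n"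
  shows
    "(\<forall>N. open N \<and> p \<in> N \<longrightarrow>
        (\<exists>U J c. open U \<and> p \<in> U \<and> U \<subseteq> N \<inter> M \<and>
           section_curve M \<A> f \<gamma> P J c \<and> c ` J \<subseteq> U \<and>
           P \<inter> f ` U = (f \<circ> c) ` J \<and>
           (\<forall>e1 e2. positive_orthonormal_basis n e1 e2 \<longrightarrow>
              three_half_cusp (plane_coords (f p) e1 e2 \<circ> (f \<circ> c))))) \<and>
     (\<forall>J c e1 e2 chart A \<eta>.
        section_curve M \<A> f \<gamma> P J c \<and> positive_orthonormal_basis n e1 e2 \<and>
        chart \<in> \<A> \<and> null_vector_field f \<gamma> chart A \<eta> \<longrightarrow>
          three_half_cusp (plane_coords (f p) e1 e2 \<circ> (f \<circ> c)) \<and>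
          cuspidal_edge_curvature f \<gamma> chart \<eta> 0 =
            plane_cuspidal_curvature (plane_coords (f p) e1 e2 \<circ> (f \<circ> c)))"
proof -
  obtain W \<Phi> C D \<Psi> where E: "local_coordinates M \<A> W \<Phi>" "p \<in> W" "\<Phi> p = 0"
    "diffeo_between C D \<Psi>" "f ` W \<subseteq> C" "\<forall>q\<in>W. \<Psi> (f q) = standard_cuspidal_edge (\<Phi> q)"
    using assms(3) unfolding cuspidal_edge_def by blast
  interpret cuspidal_edge_coordinates M \<A> f p W \<Phi> C D \<Psi> I \<gamma> n
    by unfold_locales (use assms E in auto)
  \<comment> \<open>The cusp property does not refer to a chart, so any chart around
    \<open>p\<close> serves as an auxiliary one. For the curvature it has to be the chart in which
    \<open>\<eta>\<close> is expressed.\<close>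
  obtain U0 \<phi>0 where ch: "(U0, \<phi>0) \<in> \<A>" "p \<in> U0"
    by (rule chart_at_p)
  have cusp: "three_half_cusp (plane_coords (f p) e1 e2 \<circ> (f \<circ> c))"
    if "section_curve M \<A> f \<gamma> P J c" "positive_orthonormal_basis n e1 e2" for J c e1 e2
    by (rule section_three_half_cusp[OF that(1) assms(6) ch that(2)])
  have curvature: "cuspidal_edge_curvature f \<gamma> chart \<eta> 0 =
      plane_cuspidal_curvature (plane_coords (f p) e1 e2 \<circ> (f \<circ> c))"
    if "section_curve M \<A> f \<gamma> P J c" "positive_orthonormal_basis n e1 e2" "chart \<in> \<A>"
      "null_vector_field f \<gamma> chart A \<eta>" for J c e1 e2 chart A \<eta>
  proof -
    obtain U \<phi> where c: "chart = (U, \<phi>)"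
      by fastforce
    have "p \<in> U"
      using that(4) \<gamma>_0 by (simp add: c null_vector_field_def)
    then show ?thesis
      using section_curvature[OF that(1) assms(6) _ _ that(2), of U \<phi> A \<eta>] that(3,4) by (simp add: c)
  qed
  show ?thesis
  proof (intro conjI allI impI; (elim conjE)?)
    fix N assume "open N" "p \<in> N"
    from section_curve_exists[OF this assms(6)] cusp
    show "\<exists>U J c. open U \<and> p \<in> U \<and> U \<subseteq> N \<inter> M \<and>
           section_curve M \<A> f \<gamma> P J c \<and> c ` J \<subseteq> U \<and>
           P \<inter> f ` U = (f \<circ> c) ` J \<and>
           (\<forall>e1 e2. positive_orthonormal_basis n e1 e2 \<longrightarrow>
              three_half_cusp (plane_coords (f p) e1 e2 \<circ> (f \<circ> c)))"
      by meson
  qed (rule cusp curvature; assumption)+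
qed

end
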